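(* Let $a>4$, let $L:\mathbb{R}^2\to\mathbb{R}^2$ be the autonomous, orientation and area preserving Lozi map $L(x,y)=(1+y-a|x|,\,-x)$, let $R=\frac{a}{4(a-2)}$ and $S=[-R,R]\times[-R,R]$. Put $$H_1=\{(x,y)\in L(S)\cap S: y>0\},\quad H_2=\{(x,y)\in L(S)\cap S: y<0\},$$ $$V_1=\{(x,y)\in L^{-1}(S)\cap S: x<0\},\quad V_2=\{(x,y)\in L^{-1}(S)\cap S: x>0\}.$$ Then there are constants $\mu_h,\mu_v\ge 0$ and $\nu_h,\nu_v\in(0,1)$ such that $H_1,H_2$ are disjoint $\mu_h$-horizontal strips, $V_1,V_2$ are disjoint $\mu_v$-vertical strips, and Assumptions 1 and 2 of the autonomous Conley-Moser conditions (stated in the context) hold for $L$ on $S$ with these strips and constants. Consequently $L$ possesses a chaotic saddle inside $S$: there is a hyperbolic $L$-invariant Cantor set $\Lambda\subset S$ and a homeomorphism $\phi:\Lambda\to\Sigma^2$ with $\phi\circ L|_\Lambda=\sigma\circ\phi$, where $\sigma$ is the full shift on $\Sigma^2=\{1,2\}^{\mathbb{Z}}$.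
   Context: The inverse of $L$ is $L^{-1}(x,y)=(-y,\,x+a|y|-1)$. **Curves and strips** (relative to the square $S=[-R,R]^2$). A $\mu_v$-vertical curve is the graph $\{(v(y),y)\}$ of a function $x=v(y)$ on $[-R,R]$ with $-R\le v(y)\le R$ and $|v(y_1)-v(y_2)|\le\mu_v|y_1-y_2|$ for all $y_1,y_2\in[-R,R]$. A $\mu_h$-horizontal curve is the graph of a function $y=h(x)$ on $[-R,R]$ with $-R\le h(x)\le R$ and $|h(x_1)-h(x_2)|\le\mu_h|x_1-x_2|$ for all $x_1,x_2\in[-R,R]$. Given two $\mu_v$-vertical curves with $v_1(y)<v_2(y)$ for all $y\in[-R,R]$, the corresponding $\mu_v$-vertical strip is $V=\{(x,y): x\in[v_1(y),v_2(y)],\ y\in[-R,R]\}$, with width $d(V)=\max_{y\in[-R,R]}|v_2(y)-v_1(y)|$. Given two $\mu_h$-horizontal curves with $h_1(x)<h_2(x)$ for all $x\in[-R,R]$, the corresponding $\mu_h$-horizontal strip is $H=\{(x,y): y\in[h_1(x),h_2(x)],\ x\in[-R,R]\}$, with width $d(H)=\max_{x\in[-R,R]}|h_2(x)-h_1(x)|$. The vertical boundary of a vertical strip consists of the two curves $v_1,v_2$, and its horizontal boundary is its part on $y=\pm R$. The horizontal boundary of a horizontal strip consists of the two curves $h_1,h_2$, and its vertical boundary is its part on $x=\pm R$. **Autonomous Conley-Moser conditions** for $L$ on $S$, with $I=\{1,2\}$, disjoint $\mu_h$-horizontal strips $H_i$ and disjoint $\mu_v$-vertical strips $V_i$, $i\in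 I$: *Assumption 1.* $0\le\mu_v\mu_h<1$, and $L$ maps $V_i$ homeomorphically onto $H_i$ for each $i\in I$. Moreover, the horizontal boundaries of $V_i$ map to the horizontal boundaries of $H_i$ and the vertical boundaries of $V_i$ map to the vertical boundaries of $H_i$. *Assumption 2.* If $H$ is a $\mu_h$-horizontal strip contained in $\bigcup_{i\in I}H_i$, then for every $i\in I$ the set $\tilde H_i=L(H)\cap H_i$ is a $\mu_h$-horizontal strip and $d(\tilde H_i)\le\nu_h\,d(H)$, where $0<\nu_h<1$. Similarly, if $V$ is a $\mu_v$-vertical strip contained in $\bigcup_{i\in I}V_i$, then for every $i\in I$ the set $\tilde V_i=L^{-1}(V)\cap V_i$ is a $\mu_v$-vertical strip and $d(\tilde V_i)\le\nu_v\,d(V)$, where $0<\nu_v<1$. (The constants $\nu_h,\nu_v$ do not depend on $H$, $V$, $i$.) **Chaotic saddle.** A hyperbolic invariant set on which the dynamics is topologically conjugate to a Bernoulli shift. Here $\Sigma^2=\{1,2\}^{\mathbb{Z}}$ carries the product topology and $\sigma$ is the shift $(\sigma(s))_k=s_{k+1}$. Invariant means $L(\Lambda)=\Lambda$. Hyperbolic is meant in the usual sense for a compact invariant set; since $L$ is linear up to translation off the line $x=0$, this includes that $\Lambda$ is disjoint from $\{x=0\}$, so that $DL$ exists at all points of $\Lambda$. *)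

theory Defs
  imports "HOL-Analysis.Analysis"
begin

definition lozi :: "real \<Rightarrow> real \<times> real \<Rightarrow> real \<times> real" where
  "lozi a = (\<lambda>(x, y). (1 + y - a * \<bar>x\<bar>, - x))"

lemma bij_lozi: "bij (lozi a)"
  and inv_lozi: "inv (lozi a) = (\<lambda>(x, y). (- y, x + a * \<bar>y\<bar> - 1))"
proof -
  let ?g = "\<lambda>(x, y). (- y, x + a * \<bar>y\<bar> - 1)"
  have gl: "?g \<circ> lozi a = id" and lg: "lozi a \<circ> ?g = id"
    by (auto simp: lozi_def fun_eq_iff)
  then show "bij (lozi a)" by (rule o_bij)
  show "inv (lozi a) = ?g"
    by (rule inv_unique_comp) (use gl lg in auto)
qed

text \<open>
  A curve in the square \<open>[-R, R] \<times> [-R, R]\<close> is given by the function whose graph it is: over \<open>x\<close> for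
  horizontal curves, over \<open>y\<close> for vertical ones. Only the values on \<open>[-R, R]\<close> matter.
\<close>

definition strip_curve :: "real \<Rightarrow> real \<Rightarrow> (real \<Rightarrow> real) \<Rightarrow> bool" where
  "strip_curve R \<mu> f \<longleftrightarrow> f ` {-R..R} \<subseteq> {-R..R} \<and> \<mu>-lipschitz_on {-R..R} f"

definition strip_curves :: "real \<Rightarrow> real \<Rightarrow> (real \<Rightarrow> real) \<Rightarrow> (real \<Rightarrow> real) \<Rightarrow> bool" where
  "strip_curves R \<mu> f g \<longleftrightarrow>
     strip_curve R \<mu> f \<and> strip_curve R \<mu> g \<and> (\<forall>t\<in>{-R..R}. f t < g t)"

text \<open>The supremum is attained: the curves are continuous on a compact interval.\<close>

definition strip_width :: "real \<Rightarrow> (real \<Rightarrow> real) \<Rightarrow> (real \<Rightarrow> real) \<Rightarrow> real" where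
  "strip_width R f g = (SUP t\<in>{-R..R}. \<bar>g t - f t\<bar>)"

definition hstrip :: "real \<Rightarrow> (real \<Rightarrow> real) \<Rightarrow> (real \<Rightarrow> real) \<Rightarrow> (real \<times> real) set" where
  "hstrip R h1 h2 = {(x, y). x \<in> {-R..R} \<and> y \<in> {h1 x..h2 x}}"

definition vstrip :: "real \<Rightarrow> (real \<Rightarrow> real) \<Rightarrow> (real \<Rightarrow> real) \<Rightarrow> (real \<times> real) set" where
  "vstrip R v1 v2 = {(x, y). y \<in> {-R..R} \<and> x \<in> {v1 y..v2 y}}"

definition horizontal_strip :: "real \<Rightarrow> real \<Rightarrow> (real \<times> real) set \<Rightarrow> bool" where
  "horizontal_strip R \<mu> H \<longleftrightarrow> (\<exists>h1 h2. strip_curves R \<mu> h1 h2 \<and> H = hstrip R h1 h2)"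

definition vertical_strip :: "real \<Rightarrow> real \<Rightarrow> (real \<times> real) set \<Rightarrow> bool" where
  "vertical_strip R \<mu> V \<longleftrightarrow> (\<exists>v1 v2. strip_curves R \<mu> v1 v2 \<and> V = vstrip R v1 v2)"

definition hstrip_hboundary :: "real \<Rightarrow> (real \<Rightarrow> real) \<Rightarrow> (real \<Rightarrow> real) \<Rightarrow> (real \<times> real) set" where
  "hstrip_hboundary R h1 h2 = (\<lambda>x. (x, h1 x)) ` {-R..R} \<union> (\<lambda>x. (x, h2 x)) ` {-R..R}"

definition hstrip_vboundary :: "real \<Rightarrow> (real \<Rightarrow> real) \<Rightarrow> (real \<Rightarrow> real) \<Rightarrow> (real \<times> real) set" where
  "hstrip_vboundary R h1 h2 = {p \<in> hstrip R h1 h2. fst p = - R \<or> fst p = R}"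

definition vstrip_vboundary :: "real \<Rightarrow> (real \<Rightarrow> real) \<Rightarrow> (real \<Rightarrow> real) \<Rightarrow> (real \<times> real) set" where
  "vstrip_vboundary R v1 v2 = (\<lambda>y. (v1 y, y)) ` {-R..R} \<union> (\<lambda>y. (v2 y, y)) ` {-R..R}"

definition vstrip_hboundary :: "real \<Rightarrow> (real \<Rightarrow> real) \<Rightarrow> (real \<Rightarrow> real) \<Rightarrow> (real \<times> real) set" where
  "vstrip_hboundary R v1 v2 = {p \<in> vstrip R v1 v2. snd p = - R \<or> snd p = R}"

text \<open>
  The curves bounding a strip are determined on \<open>[-R, R]\<close> by the strip, so boundaries and widths do
  not depend on the choice of the curves in the two definitions below. Boundaries are required to map
  onto boundaries.
\<close>

definition conley_moser1 ::
  "(real \<times> real \<Rightarrow> real \<times> real) \<Rightarrow> real \<Rightarrow> real \<Rightarrow> real \<Rightarrow>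
    (nat \<Rightarrow> (real \<times> real) set) \<Rightarrow> (nat \<Rightarrow> (real \<times> real) set) \<Rightarrow> bool" where
  "conley_moser1 F R \<mu>h \<mu>v H V \<longleftrightarrow>
     0 \<le> \<mu>v * \<mu>h \<and> \<mu>v * \<mu>h < 1 \<and>
     (\<forall>i\<in>{1, 2}.
        homeomorphic_map (top_of_set (V i)) (top_of_set (H i)) F \<and>
        (\<exists>h1 h2 v1 v2.
           strip_curves R \<mu>h h1 h2 \<and> H i = hstrip R h1 h2 \<and>
           strip_curves R \<mu>v v1 v2 \<and> V i = vstrip R v1 v2 \<and>
           F ` vstrip_hboundary R v1 v2 = hstrip_hboundary R h1 h2 \<and>
           F ` vstrip_vboundary R v1 v2 = hstrip_vboundary R h1 h2))"

definition conley_moser2 ::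
  "(real \<times> real \<Rightarrow> real \<times> real) \<Rightarrow> real \<Rightarrow> real \<Rightarrow> real \<Rightarrow> real \<Rightarrow> real \<Rightarrow>
    (nat \<Rightarrow> (real \<times> real) set) \<Rightarrow> (nat \<Rightarrow> (real \<times> real) set) \<Rightarrow> bool" where
  "conley_moser2 F R \<mu>h \<mu>v \<nu>h \<nu>v H V \<longleftrightarrow>
     0 < \<nu>h \<and> \<nu>h < 1 \<and> 0 < \<nu>v \<and> \<nu>v < 1 \<and>
     (\<forall>h1 h2. strip_curves R \<mu>h h1 h2 \<and> hstrip R h1 h2 \<subseteq> (\<Union>i\<in>{1, 2}. H i) \<longrightarrow>
        (\<forall>i\<in>{1, 2}. \<exists>g1 g2.
           strip_curves R \<mu>h g1 g2 \<and> F ` hstrip R h1 h2 \<inter> H i = hstrip R g1 g2 \<and>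
           strip_width R g1 g2 \<le> \<nu>h * strip_width R h1 h2)) \<and>
     (\<forall>v1 v2. strip_curves R \<mu>v v1 v2 \<and> vstrip R v1 v2 \<subseteq> (\<Union>i\<in>{1, 2}. V i) \<longrightarrow>
        (\<forall>i\<in>{1, 2}. \<exists>w1 w2.
           strip_curves R \<mu>v w1 w2 \<and> F -` vstrip R v1 v2 \<inter> V i = vstrip R w1 w2 \<and>
           strip_width R w1 w2 \<le> \<nu>v * strip_width R v1 v2))"

definition cantor_set :: "'a::metric_space set \<Rightarrow> bool" where
  "cantor_set \<Lambda> \<longleftrightarrow> \<Lambda> \<noteq> {} \<and> compact \<Lambda> \<and> (\<forall>p\<in>\<Lambda>. p islimpt \<Lambda>) \<and>
     (\<forall>p\<in>\<Lambda>. connected_component_set \<Lambda> p = {p})"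

text \<open>
  Only near \<open>\<Lambda>\<close> is \<open>f\<close> required to be a \<open>C\<^sup>1\<close> diffeomorphism onto its image; \<open>f\<close> and \<open>inv f\<close> then
  have derivatives of all iterates at the points of \<open>\<Lambda>\<close>. The constants \<open>C\<close> and \<open>r\<close> are uniform over \<open>\<Lambda>\<close>.
\<close>

definition hyperbolic_set :: "('a::euclidean_space \<Rightarrow> 'a) \<Rightarrow> 'a set \<Rightarrow> bool" where
  "hyperbolic_set f \<Lambda> \<longleftrightarrow>
     bij f \<and> compact \<Lambda> \<and> f ` \<Lambda> = \<Lambda> \<and>
     (\<exists>U (f' :: 'a \<Rightarrow> 'a \<Rightarrow>\<^sub>L 'a). open U \<and> \<Lambda> \<subseteq> U \<and> continuous_on U f' \<and>
        (\<forall>p\<in>U. (f has_derivative blinfun_apply (f' p)) (at p) \<and> bij (blinfun_apply (f' p)))) \<and>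
     (\<exists>Es Eu C r. 0 < C \<and> 0 < r \<and> r < 1 \<and>
        (\<forall>p\<in>\<Lambda>.
           subspace (Es p) \<and> subspace (Eu p) \<and>
           Es p \<inter> Eu p = {0} \<and> (\<forall>w. \<exists>u\<in>Es p. \<exists>v\<in>Eu p. w = u + v) \<and>
           frechet_derivative f (at p) ` Es p = Es (f p) \<and>
           frechet_derivative f (at p) ` Eu p = Eu (f p) \<and>
           (\<forall>n. \<forall>v\<in>Es p. norm (frechet_derivative (f ^^ n) (at p) v) \<le> C * r ^ n * norm v) \<and>
           (\<forall>n. \<forall>v\<in>Eu p. norm (frechet_derivative (inv f ^^ n) (at p) v) \<le> C * r ^ n * norm v)))"

definition full_shift_space :: "(int \<Rightarrow> nat) topology" where
  "full_shift_space = product_topology (\<lambda>_. discrete_topology {1, 2}) UNIV"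

definition shift :: "(int \<Rightarrow> nat) \<Rightarrow> int \<Rightarrow> nat" where
  "shift s = (\<lambda>k. s (k + 1))"

end

theory Submission
  imports Defs
begin

text \<open>
  The map \<open>L\<close> is reversible: with \<open>T (x, y) = (-y, -x)\<close> one has \<open>L\<inverse> = T L T\<close>, and \<open>T\<close> exchanges
  vertical and horizontal strips, so only the images of horizontal strips have to be studied. The
  image of the graph of a curve \<open>h\<close> meets the line over \<open>x\<close> in the half-plane \<open>s y > 0\<close> at \<open>y = s u\<close>,
  where \<open>u\<close> solves \<open>a u = 1 - x + h (-s u)\<close>; for curves with Lipschitz constant \<open>1/2\<close> the solution is
  unique and depends on \<open>x\<close> and \<open>h\<close> with Lipschitz constant \<open>1 / (a - 1/2) \<le> 2/7\<close>.

  The first coordinates of an orbit satisfy \<open>x\<^sub>k\<^sub>+\<^sub>1 + x\<^sub>k\<^sub>-\<^sub>1 = 1 - a \<bar>x\<^sub>k\<bar>\<close>, that is,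
  \<open>x\<^sub>k = e\<^sub>k (1 - x\<^sub>k\<^sub>+\<^sub>1 - x\<^sub>k\<^sub>-\<^sub>1) / a\<close> where \<open>e\<^sub>k\<close> is the sign of \<open>x\<^sub>k\<close>. For given signs the right-hand
  side is a contraction with constant \<open>2/a\<close> of the sequences bounded by \<open>R < 1/2\<close>, so every
  sequence of signs belongs to exactly one orbit in the square. The invariant line fields of the
  derivative are fixed points of a contraction as well.
\<close>

section \<open>A contraction principle for bounded functions\<close>

text \<open>The iterates of 0 converge pointwise at a rate uniform in the argument, which stands in
  for completeness of a function space. The arguments carry no topology, so this serves both
  sequences over \<open>int\<close> and slope fields on the plane.\<close>

lemma bounded_contraction_fixpoint:
  fixes \<Phi> :: "('a \<Rightarrow> real) \<Rightarrow> 'a \<Rightarrow> real"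
  assumes c: "0 \<le> c" "c < 1" and B: "0 \<le> B"
    and bound: "\<And>m p. (\<And>q. \<bar>m q\<bar> \<le> B) \<Longrightarrow> \<bar>\<Phi> m p\<bar> \<le> B"
    and contr: "\<And>m m' d p. (\<And>q. \<bar>m q\<bar> \<le> B) \<Longrightarrow> (\<And>q. \<bar>m' q\<bar> \<le> B) \<Longrightarrow>
      (\<And>q. \<bar>m q - m' q\<bar> \<le> d) \<Longrightarrow> \<bar>\<Phi> m p - \<Phi> m' p\<bar> \<le> c * d"
  obtains m where "\<And>p. \<bar>m p\<bar> \<le> B" and "\<Phi> m = m"
proof -
  define M where "M n = (\<Phi> ^^ n) (\<lambda>_. 0)" for n
  have M_Suc: "M (Suc n) = \<Phi> (M n)" for n by (simp add: M_def)
  have MB: "\<bar>M n p\<bar> \<le> B" for n p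
  proof (induction n arbitrary: p)
    case 0 then show ?case using B by (simp add: M_def)
  next
    case (Suc n) then show ?case unfolding M_Suc by (rule bound)
  qed
  have dM: "\<bar>M (n + k) p - M n p\<bar> \<le> c ^ n * (2 * B)" for n k p
  proof (induction n arbitrary: p)
    case 0 then show ?case using MB[of k p] MB[of 0 p] by simp
  next
    case (Suc n)
    then show ?case
      using contr[OF MB MB Suc, where p = p] by (simp add: M_Suc mult.assoc)
  qed
  have lim0: "(\<lambda>n. c ^ n * K) \<longlonglongrightarrow> 0" for K
    using LIMSEQ_realpow_zero[OF c] by (rule tendsto_mult_left_zero)
  have conv: "convergent (\<lambda>n. M n p)" for p
  proof (rule Cauchy_convergent, rule metric_CauchyI)
    fix e :: real assume "0 < e"
    \<comment> \<open>Two later iterates are both compared with \<open>M N\<close>, each at a cost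
      of \<open>c ^ N * (2 * B)\<close>.\<close>
    then have "\<forall>\<^sub>F n in sequentially. c ^ n * (4 * B) < e"
      by (rule order_tendstoD(2)[OF lim0])
    then obtain N where N: "c ^ N * (4 * B) < e" by (auto simp: eventually_sequentially)
    show "\<exists>N. \<forall>m\<ge>N. \<forall>n\<ge>N. dist (M m p) (M n p) < e"
    proof (intro exI allI impI)
      fix m n assume "N \<le> m" "N \<le> n"
      then obtain k l where "m = N + k" "n = N + l" by (auto simp: le_iff_add)
      then show "dist (M m p) (M n p) < e"
        using dM[of N k p] dM[of N l p] N by (simp add: dist_real_def abs_le_iff abs_less_iff)
    qed
  qed
  define m where "m p = lim (\<lambda>n. M n p)" for p
  have lim: "(\<lambda>n. M n p) \<longlonglongrightarrow> m p" for p
    using conv by (simp add: m_def convergent_LIMSEQ_iff)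
  have mB: "\<bar>m p\<bar> \<le> B" for p
    by (rule LIMSEQ_le_const2[OF tendsto_rabs[OF lim]]) (use MB in auto)
  have dm: "\<bar>m p - M n p\<bar> \<le> c ^ n * (2 * B)" for n p
  proof (rule LIMSEQ_le_const2)
    show "(\<lambda>k. \<bar>M (k + n) p - M n p\<bar>) \<longlonglongrightarrow> \<bar>m p - M n p\<bar>"
      by (intro tendsto_intros LIMSEQ_ignore_initial_segment lim)
    show "\<exists>N. \<forall>k\<ge>N. \<bar>M (k + n) p - M n p\<bar> \<le> c ^ n * (2 * B)"
      using dM[of n _ p] by (auto simp: add.commute)
  qed
  have "\<Phi> m p = m p" for p
  proof -
    have *: "\<bar>\<Phi> m p - m p\<bar> \<le> c ^ Suc n * (4 * B)" for n
      using contr[of m "M n" "c ^ n * (2 * B)" p, OF mB MB dm] dm[of p "Suc n"] by (simp add: M_Suc)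
    have "\<bar>\<Phi> m p - m p\<bar> \<le> 0"
      by (rule LIMSEQ_le_const[OF LIMSEQ_Suc[OF lim0]]) (use * in auto)
    then show ?thesis by simp
  qed
  then show thesis using that mB by blast
qed

subsection \<open>Strips\<close>

definition reversor :: "real \<times> real \<Rightarrow> real \<times> real" where
  "reversor = (\<lambda>(x, y). (- y, - x))"

lemma reversor_reversor [simp]: "reversor (reversor p) = p"
  by (simp add: reversor_def split: prod.split)

lemma image_reversor_eqI:
  assumes "\<And>x y. (x, y) \<in> B \<longleftrightarrow> reversor (x, y) \<in> A"
  shows "reversor ` A = B"
proof -
  have mem: "p \<in> B \<longleftrightarrow> reversor p \<in> A" for p using assms by (cases p) simp
  show ?thesis
  proof (intro equalityI subsetI)
    fix p assume "p \<in> B"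
    then have "reversor (reversor p) \<in> reversor ` A" unfolding mem by (rule imageI)
    then show "p \<in> reversor ` A" by simp
  qed (auto simp: mem)
qed

lemma vimage_lozi: "lozi a -` A = reversor ` lozi a ` reversor ` A"
proof -
  have 1: "p = reversor (lozi a (reversor (lozi a p)))" for p
    by (cases p) (simp add: reversor_def lozi_def)
  have 2: "lozi a (reversor (lozi a (reversor p))) = p" for p
    by (cases p) (simp add: reversor_def lozi_def)
  show ?thesis
  proof (intro subset_antisym subsetI)
    fix p assume "p \<in> lozi a -` A"
    then show "p \<in> reversor ` lozi a ` reversor ` A"
      using 1[of p] by (metis imageI vimageD)
  next
    fix p assume "p \<in> reversor ` lozi a ` reversor ` A"
    then show "p \<in> lozi a -` A" using 2 by auto
  qed
qed

lemma reversor_vstrip: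
  "reversor ` vstrip R v1 v2 = hstrip R (\<lambda>x. - v2 (- x)) (\<lambda>x. - v1 (- x))"
  by (rule image_reversor_eqI) (auto simp: reversor_def vstrip_def hstrip_def)

lemma reversor_hstrip:
  "reversor ` hstrip R h1 h2 = vstrip R (\<lambda>y. - h2 (- y)) (\<lambda>y. - h1 (- y))"
proof -
  have "reversor ` reversor ` vstrip R (\<lambda>y. - h2 (- y)) (\<lambda>y. - h1 (- y)) =
    reversor ` hstrip R h1 h2"
    by (simp add: reversor_vstrip)
  then show ?thesis by (simp add: image_image)
qed

lemma strip_curve_reflect:
  assumes "strip_curve R \<mu> f"
  shows "strip_curve R \<mu> (\<lambda>t. - f (- t))"
  unfolding strip_curve_def lipschitz_on_def
proof (intro conjI ballI)
  show "(\<lambda>t. - f (- t)) ` {-R..R} \<subseteq> {-R..R}"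
    using assms by (auto simp: strip_curve_def image_subset_iff minus_le_iff)
  show "0 \<le> \<mu>" using assms by (simp add: strip_curve_def lipschitz_on_def)
  fix s t assume st: "s \<in> {-R..R}" "t \<in> {-R..R}"
  have "dist (f (-s)) (f (-t)) \<le> \<mu> * dist (-s) (-t)"
    using assms st unfolding strip_curve_def by (intro lipschitz_onD) auto
  then show "dist (- f (- s)) (- f (- t)) \<le> \<mu> * dist s t"
    by (simp add: dist_minus)
qed

lemma strip_curves_reflect:
  "strip_curves R \<mu> f g \<Longrightarrow> strip_curves R \<mu> (\<lambda>t. - g (- t)) (\<lambda>t. - f (- t))"
  unfolding strip_curves_def by (auto intro: strip_curve_reflect)

lemma strip_width_reflect:
  "strip_width R (\<lambda>t. - g (- t)) (\<lambda>t. - f (- t)) = strip_width R f g"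
proof -
  have "strip_width R f g = (SUP t\<in>uminus ` {-R..R}. \<bar>g t - f t\<bar>)"
    by (simp add: strip_width_def)
  also have "\<dots> = (SUP t\<in>{-R..R}. \<bar>g (- t) - f (- t)\<bar>)"
    by (simp only: image_image)
  finally show ?thesis by (simp add: strip_width_def)
qed

lemma strip_width_ge:
  assumes "strip_curves R \<mu> f g" "t \<in> {-R..R}"
  shows "\<bar>g t - f t\<bar> \<le> strip_width R f g"
  unfolding strip_width_def
proof (rule cSUP_upper[OF assms(2)])
  show "bdd_above ((\<lambda>t. \<bar>g t - f t\<bar>) ` {-R..R})"
  proof (rule bdd_aboveI2)
    fix x assume "x \<in> {-R..R}"
    then have "f x \<in> {-R..R}" "g x \<in> {-R..R}"
      using assms unfolding strip_curves_def strip_curve_def by blast+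
    then show "\<bar>g x - f x\<bar> \<le> 2 * R" by auto
  qed
qed

lemma strip_width_le:
  assumes "0 \<le> R" "\<And>t. t \<in> {-R..R} \<Longrightarrow> \<bar>g t - f t\<bar> \<le> d"
  shows "strip_width R f g \<le> d"
  unfolding strip_width_def using assms by (intro cSUP_least) auto

section \<open>Images and preimages of strips under the map\<close>

locale lozi_horseshoe =
  fixes a R :: real
  assumes a: "a > 4" and R_eq: "R = a / (4 * (a - 2))"
begin

abbreviation square :: "(real \<times> real) set" where
  "square \<equiv> {-R..R} \<times> {-R..R}"

text \<open>Both bounds come from \<open>a > 4\<close>, the second through
  \<open>R * (a - 2) = a / 4\<close>. For \<open>x\<close> and \<open>t\<close> in
  \<open>{-R..R}\<close> they give \<open>0 < 1 - x + t < a * R\<close>, so every \<open>u\<close>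
  with \<open>a * u = 1 - x + t\<close> lies strictly between 0 and \<open>R\<close>.\<close>

lemma R_pos: "0 < R" and R_less: "R < 1/2" and aR: "1 + 2 * R < a * R"
proof -
  show "0 < R" using a by (simp add: R_eq)
  show "R < 1/2" using a by (simp add: R_eq field_simps)
  have "R * (a - 2) = a / 4" using a by (simp add: R_eq field_simps)
  then show "1 + 2 * R < a * R" using a by (simp add: algebra_simps)
qed

lemma expansion_ge: "a * u - u / 2 \<ge> 7/2 * u" if "u \<ge> 0"
  using mult_right_mono[of 4 a u] a that by linarith

lemma curve_diff:
  assumes "strip_curve R (1/2) h" "s \<in> {- 1, 1}" "u \<in> {0..R}" "w \<in> {0..R}"
  shows "\<bar>h (- s * u) - h (- s * w)\<bar> \<le> \<bar>u - w\<bar> / 2"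
proof -
  have "dist (h (- s * u)) (h (- s * w)) \<le> 1/2 * dist (- s * u) (- s * w)"
    using assms unfolding strip_curve_def by (intro lipschitz_onD) auto
  then show ?thesis using assms(2) by (auto simp: dist_real_def abs_minus_commute)
qed

text \<open>The term \<open>a * u\<close> grows at a rate above 4 while the curve varies at a rate
  of at most 1/2, so the difference increases at a rate of at least 7/2. As an equivalence, this
  locates points relative to a crossing.\<close>

lemma crossing_le:
  assumes "strip_curve R (1/2) h" "s \<in> {- 1, 1}" "u \<in> {0..R}" "w \<in> {0..R}"
  shows "a * u - h (- s * u) \<le> a * w - h (- s * w) \<longleftrightarrow> u \<le> w"
proof -
  have *: "7/2 * (w - u) \<le> (a * w - h (- s * w)) - (a * u - h (- s * u))"
    if "u \<le> w" "u \<in> {0..R}" "w \<in> {0..R}" for u w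
  proof -
    have "7/2 * (w - u) \<le> (a * w - a * u) - (w - u) / 2"
      using expansion_ge[of "w - u"] that(1) by (simp add: right_diff_distrib)
    moreover have "h (- s * w) - h (- s * u) \<le> (w - u) / 2"
      using abs_le_D2[OF curve_diff[OF assms(1,2) that(2,3)]] that(1) by simp
    ultimately show ?thesis by argo
  qed
  show ?thesis
    using *[of u w] *[of w u] assms(3,4) by (cases "u \<le> w") auto
qed

text \<open>Intermediate value theorem for \<open>a * u - h (- s * u)\<close> on
  \<open>{0..R}\<close>: the value at 0 is at most \<open>R < 1 - R\<close>, the value at
  \<open>R\<close> is at least \<open>a * R - R > 1 + R\<close>, and \<open>1 - x\<close> lies
  between.\<close>

lemma crossing_exists:
  assumes "strip_curve R (1/2) h" "s \<in> {- 1, 1}"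
  obtains U where "\<And>x. x \<in> {-R..R} \<Longrightarrow> 0 < U x" "\<And>x. x \<in> {-R..R} \<Longrightarrow> U x \<le> R"
    "\<And>x. x \<in> {-R..R} \<Longrightarrow> a * U x = 1 - x + h (- s * U x)"
proof -
  have hR: "h t \<in> {-R..R}" if "t \<in> {-R..R}" for t
    using assms that unfolding strip_curve_def by blast
  have "\<exists>u. 0 < u \<and> u \<le> R \<and> a * u = 1 - x + h (- s * u)" if x: "x \<in> {-R..R}" for x
  proof -
    have "continuous_on {-R..R} h"
      using assms unfolding strip_curve_def by (blast intro: lipschitz_on_continuous_on)
    then have "continuous_on {0..R} (\<lambda>u. h (- s * u))"
      by (rule continuous_on_compose2) (use assms(2) in \<open>auto intro!: continuous_intros\<close>)
    then have cont: "continuous_on {0..R} (\<lambda>u. a * u - h (- s * u))"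
      by (intro continuous_intros)
    have "a * 0 - h (- s * 0) < 1 - x"
      using hR[of 0] x R_less R_pos by auto
    moreover have "1 - x \<le> a * R - h (- s * R)"
      using hR[of "- s * R"] x aR R_pos assms(2) by auto
    ultimately obtain u where u: "0 \<le> u" "u \<le> R" "a * u - h (- s * u) = 1 - x"
      using IVT'[OF _ _ _ cont, of "1 - x"] R_pos by auto
    moreover have "u \<noteq> 0" using u(3) \<open>a * 0 - h (- s * 0) < 1 - x\<close> by auto
    ultimately show ?thesis by (intro exI[of _ u]) auto
  qed
  then show thesis using that by metis
qed

text \<open>For \<open>y = s * u\<close> with \<open>u > 0\<close> the preimage of
  \<open>(x, y)\<close> is \<open>(- s * u, x + a * u - 1)\<close>. Membership in the image is thus
  a pair of inequalities in \<open>u\<close>, which monotonicity solves as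
  \<open>U1 x \<le> u \<le> U2 x\<close> with the crossings of the two bounding curves.\<close>

lemma hstrip_image:
  assumes h: "strip_curves R (1/2) h1 h2" and s: "s \<in> {- 1, 1}"
  obtains g1 g2 where "strip_curves R (1/2) g1 g2"
    "lozi a ` hstrip R h1 h2 \<inter> {p \<in> square. 0 < s * snd p} = hstrip R g1 g2"
    "strip_width R g1 g2 \<le> 1/2 * strip_width R h1 h2"
proof -
  have c1: "strip_curve R (1/2) h1" and c2: "strip_curve R (1/2) h2"
    and less: "\<And>t. t \<in> {-R..R} \<Longrightarrow> h1 t < h2 t"
    using h by (auto simp: strip_curves_def)
  obtain U1 where U1: "\<And>x. x \<in> {-R..R} \<Longrightarrow> 0 < U1 x" "\<And>x. x \<in> {-R..R} \<Longrightarrow> U1 x \<le> R"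
    "\<And>x. x \<in> {-R..R} \<Longrightarrow> a * U1 x = 1 - x + h1 (- s * U1 x)"
    using crossing_exists[OF c1 s] by metis
  obtain U2 where U2: "\<And>x. x \<in> {-R..R} \<Longrightarrow> 0 < U2 x" "\<And>x. x \<in> {-R..R} \<Longrightarrow> U2 x \<le> R"
    "\<And>x. x \<in> {-R..R} \<Longrightarrow> a * U2 x = 1 - x + h2 (- s * U2 x)"
    using crossing_exists[OF c2 s] by metis
  have range: "- s * u \<in> {-R..R}" if "u \<in> {0..R}" for u
    using s that by auto
  have U1R: "U1 x \<in> {0..R}" and U2R: "U2 x \<in> {0..R}" if "x \<in> {-R..R}" for x
    using U1[OF that] U2[OF that] by auto
  have U1_le: "U1 x \<le> u \<longleftrightarrow> 1 - x \<le> a * u - h1 (- s * u)"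
    if "x \<in> {-R..R}" "u \<in> {0..R}" for x u
    using crossing_le[OF c1 s U1R[OF that(1)] that(2)] U1(3)[OF that(1)] by linarith
  have le_U2: "u \<le> U2 x \<longleftrightarrow> a * u - h2 (- s * u) \<le> 1 - x"
    if "x \<in> {-R..R}" "u \<in> {0..R}" for x u
    using crossing_le[OF c2 s that(2) U2R[OF that(1)]] U2(3)[OF that(1)] by linarith
  have U2_le: "U2 x \<le> u \<longleftrightarrow> 1 - x \<le> a * u - h2 (- s * u)"
    if "x \<in> {-R..R}" "u \<in> {0..R}" for x u
    using crossing_le[OF c2 s U2R[OF that(1)] that(2)] U2(3)[OF that(1)] by linarith
  \<comment> \<open>At the crossing of \<open>h1\<close> the increasing function belonging to
    \<open>h2\<close> is still below \<open>1 - x\<close>, because \<open>h1 < h2\<close>.\<close>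
  have U12: "U1 x < U2 x" if x: "x \<in> {-R..R}" for x
    using U2_le[OF x U1R[OF x]] U1(3)[OF x] less[OF range[OF U1R[OF x]]] by linarith
  have width: "U2 x - U1 x \<le> 1/2 * strip_width R h1 h2" if x: "x \<in> {-R..R}" for x
  proof -
    let ?d = "U2 x - U1 x"
    \<comment> \<open>The difference splits into the gap between the curves at one abscissa and the
      variation of \<open>h1\<close>. Absorbing the latter leaves
      \<open>7/2 * ?d \<le> strip_width R h1 h2\<close>.\<close>
    have "a * ?d = (h2 (- s * U2 x) - h1 (- s * U2 x)) + (h1 (- s * U2 x) - h1 (- s * U1 x))"
      using U1(3)[OF x] U2(3)[OF x] by (simp add: right_diff_distrib)
    also have "\<dots> \<le> strip_width R h1 h2 + ?d / 2"
      using strip_width_ge[OF h range[OF U2R[OF x]]] curve_diff[OF c1 s U2R[OF x] U1R[OF x]]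
        U12[OF x] by linarith
    finally have "a * ?d - ?d / 2 \<le> strip_width R h1 h2" by simp
    then show ?thesis
      using expansion_ge[of ?d, unfolded diff_ge_0_iff_ge, OF less_imp_le[OF U12[OF x]]] U12[OF x]
      by argo
  qed
  \<comment> \<open>The same absorption yields
    \<open>7/2 * \<bar>U x - U y\<bar> \<le> \<bar>x - y\<bar>\<close>, so the slope bound 1/2
    reproduces itself.\<close>
  have lip: "\<bar>U x - U y\<bar> \<le> 1/2 * \<bar>x - y\<bar>"
    if c: "strip_curve R (1/2) h" and UR: "\<And>x. x \<in> {-R..R} \<Longrightarrow> U x \<in> {0..R}"
      and Ueq: "\<And>x. x \<in> {-R..R} \<Longrightarrow> a * U x = 1 - x + h (- s * U x)"
      and x: "x \<in> {-R..R}" and y: "y \<in> {-R..R}" for h U x y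
  proof -
    let ?d = "U x - U y"
    have "a * \<bar>?d\<bar> = \<bar>a * ?d\<bar>" using a by (simp add: abs_mult)
    also have "\<dots> = \<bar>(h (- s * U x) - h (- s * U y)) + (y - x)\<bar>"
      using Ueq[OF x] Ueq[OF y] by (simp add: algebra_simps)
    also have "\<dots> \<le> \<bar>?d\<bar> / 2 + \<bar>x - y\<bar>"
      using curve_diff[OF c s UR[OF x] UR[OF y]] by linarith
    finally show ?thesis using expansion_ge[OF abs_ge_zero, of ?d] by argo
  qed
  have curve: "strip_curve R (1/2) U1" "strip_curve R (1/2) U2"
    using lip[OF c1 U1R U1(3)] lip[OF c2 U2R U2(3)] U1R U2R R_pos
    by (fastforce simp: strip_curve_def lipschitz_on_def dist_real_def)+
  \<comment> \<open>For \<open>s = - 1\<close> the image lies below the axis, where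
    \<open>y = - u\<close> reverses the order of the curves.\<close>
  define g1 where "g1 = (if s = 1 then U1 else (\<lambda>x. - U2 x))"
  define g2 where "g2 = (if s = 1 then U2 else (\<lambda>x. - U1 x))"
  show thesis
  proof (rule that[of g1 g2])
    have "strip_curve R (1/2) (\<lambda>x. - U x)" if "strip_curve R (1/2) U" for U
      using that by (force simp: strip_curve_def lipschitz_on_def dist_minus)
    then show "strip_curves R (1/2) g1 g2"
      using curve U12 by (simp add: strip_curves_def g1_def g2_def)
    show "strip_width R g1 g2 \<le> 1/2 * strip_width R h1 h2"
      by (rule strip_width_le) (use R_pos width U12 in \<open>force simp: g1_def g2_def\<close>)+
    have "(x, y) \<in> lozi a ` hstrip R h1 h2 \<inter> {p \<in> square. 0 < s * snd p} \<longleftrightarrow>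
      (x, y) \<in> hstrip R g1 g2" for x y
    proof -
      define u where "u = s * y"
      have pre: "(x, y) \<in> lozi a ` A \<longleftrightarrow> (- y, x + a * \<bar>y\<bar> - 1) \<in> A" for A
        by (force simp: lozi_def image_iff)
      have "(x, y) \<in> lozi a ` hstrip R h1 h2 \<inter> {p \<in> square. 0 < s * snd p} \<longleftrightarrow>
        x \<in> {-R..R} \<and> 0 < u \<and> u \<le> R \<and>
          1 - x \<le> a * u - h1 (- s * u) \<and> a * u - h2 (- s * u) \<le> 1 - x"
      proof (cases "0 < u")
        case True
        then have "\<bar>y\<bar> = u" "- y = - s * u"
          "y \<in> {-R..R} \<longleftrightarrow> u \<le> R" "- y \<in> {-R..R} \<longleftrightarrow> u \<le> R"
          using s by (auto simp: u_def)
        moreover have "0 < s * y" using True by (simp add: u_def)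
        ultimately show ?thesis
          using True unfolding Int_iff pre hstrip_def by auto
      next
        case False
        then show ?thesis by (simp add: u_def)
      qed
      also have "\<dots> \<longleftrightarrow> x \<in> {-R..R} \<and> U1 x \<le> u \<and> u \<le> U2 x"
      proof (cases "x \<in> {-R..R} \<and> u \<in> {0..R}")
        case True
        then have x: "x \<in> {-R..R}" and u: "u \<in> {0..R}" by auto
        have "U1 x \<le> u \<Longrightarrow> 0 < u" using U1(1)[OF x] by linarith
        then show ?thesis
          unfolding U1_le[OF x u] le_U2[OF x u] using x u by auto
      next
        case False
        then show ?thesis using U1(1)[of x] U2(2)[of x] by force
      qed
      also have "\<dots> \<longleftrightarrow> (x, y) \<in> hstrip R g1 g2"
        using s by (auto simp: hstrip_def g1_def g2_def u_def)
      finally show ?thesis .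
    qed
    then show "lozi a ` hstrip R h1 h2 \<inter> {p \<in> square. 0 < s * snd p} = hstrip R g1 g2"
      unfolding set_eq_iff split_paired_All by blast
  qed
qed

text \<open>The reversor makes the strip horizontal and turns \<open>s * fst p < 0\<close> into
  \<open>0 < s * snd p\<close>, so \<open>hstrip_image\<close> applies with the same
  \<open>s\<close>.\<close>

lemma vstrip_vimage:
  assumes v: "strip_curves R (1/2) v1 v2" and s: "s \<in> {- 1, 1}"
  obtains w1 w2 where "strip_curves R (1/2) w1 w2"
    "lozi a -` vstrip R v1 v2 \<inter> {p \<in> square. s * fst p < 0} = vstrip R w1 w2"
    "strip_width R w1 w2 \<le> 1/2 * strip_width R v1 v2"
proof -
  obtain g1 g2 where g: "strip_curves R (1/2) g1 g2"
    and eq: "lozi a ` reversor ` vstrip R v1 v2 \<inter> {p \<in> square. 0 < s * snd p} = hstrip R g1 g2"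
    and w: "strip_width R g1 g2 \<le> 1/2 * strip_width R v1 v2"
    by (rule hstrip_image[OF strip_curves_reflect[OF v] s, folded reversor_vstrip,
          unfolded strip_width_reflect])
  have sq: "{p \<in> square. s * fst p < 0} = reversor ` {p \<in> square. 0 < s * snd p}"
    by (rule image_reversor_eqI[symmetric]) (auto simp: reversor_def)
  have "inj reversor" by (rule inj_on_inverseI[of _ reversor]) simp
  then have "lozi a -` vstrip R v1 v2 \<inter> {p \<in> square. s * fst p < 0} = reversor ` hstrip R g1 g2"
    unfolding vimage_lozi sq eq[symmetric] by (simp add: image_Int)
  then show thesis
    using that[OF strip_curves_reflect[OF g]] w
    by (simp add: reversor_hstrip strip_width_reflect)
qed

section \<open>The four strips in explicit form\<close>

text \<open>The sign 1 stands for the index 1 and the sign - 1 for the index 2. As the second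
  coordinate of \<open>lozi a p\<close> is \<open>- fst p\<close>, the preimage lies where the first
  coordinate has sign \<open>- s\<close>.\<close>

definition image_strip :: "real \<Rightarrow> (real \<times> real) set" where
  "image_strip s = lozi a ` square \<inter> {p \<in> square. 0 < s * snd p}"

definition preimage_strip :: "real \<Rightarrow> (real \<times> real) set" where
  "preimage_strip s = lozi a -` square \<inter> {p \<in> square. s * fst p < 0}"

lemma lozi_mem_image_strip: "lozi a p \<in> image_strip s \<longleftrightarrow> p \<in> preimage_strip s"
  by (cases p)
    (auto simp: image_strip_def preimage_strip_def lozi_def
      inj_image_mem_iff[OF bij_is_inj[OF bij_lozi[unfolded lozi_def]]])

lemma image_lozi_eqI:
  assumes "\<And>x y. lozi a (x, y) \<in> B \<longleftrightarrow> (x, y) \<in> A"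
  shows "lozi a ` A = B"
proof -
  have "A = lozi a -` B" unfolding set_eq_iff split_paired_All using assms by simp
  then show ?thesis by (simp add: surj_image_vimage_eq bij_is_surj[OF bij_lozi])
qed

lemma image_preimage_strip: "lozi a ` preimage_strip s = image_strip s"
  by (rule image_lozi_eqI) (rule lozi_mem_image_strip)

lemma le_div_a: "x \<le> y / a \<longleftrightarrow> a * x \<le> y" "y / a \<le> x \<longleftrightarrow> y \<le> a * x"
    "x = y / a \<longleftrightarrow> a * x = y"
  using a by (auto simp: field_simps)

text \<open>For \<open>s = 1\<close> and \<open>s = - 1\<close> the strips are bounded by the curves with \<open>r = - R\<close> and \<open>r = R\<close>.\<close>

definition hcurve :: "real \<Rightarrow> real \<Rightarrow> real \<Rightarrow> real" where
  "hcurve s r x = (s * (1 - x) + r) / a"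

definition vcurve :: "real \<Rightarrow> real \<Rightarrow> real \<Rightarrow> real" where
  "vcurve s r y = (- s * (1 + y) + r) / a"

lemma vcurve_reflect: "vcurve s r = (\<lambda>t. - hcurve s (- r) (- t))"
  by (auto simp: vcurve_def hcurve_def fun_eq_iff minus_divide_left)

text \<open>The graph is a line of slope \<open>- s / a\<close>, and
  \<open>1 + 2 * R < a * R\<close> keeps it in the square.\<close>

lemma strip_curve_hcurve:
  assumes s: "s \<in> {- 1, 1}" and r: "\<bar>r\<bar> \<le> R"
  shows "strip_curve R (1/2) (hcurve s r)"
  unfolding strip_curve_def lipschitz_on_def
proof (intro conjI ballI)
  have "- (a * R) \<le> s * (1 - x) + r \<and> s * (1 - x) + r \<le> a * R" if "x \<in> {-R..R}" for x
    using that s r aR R_less by auto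
  then show "hcurve s r ` {-R..R} \<subseteq> {-R..R}"
    by (auto simp: hcurve_def le_div_a)
  fix x y :: real
  have "hcurve s r x - hcurve s r y = s * (y - x) / a"
    by (simp add: hcurve_def diff_divide_distrib[symmetric] algebra_simps)
  then have "dist (hcurve s r x) (hcurve s r y) = \<bar>x - y\<bar> / a"
    using s a by (auto simp: dist_real_def abs_minus_commute)
  also have "\<dots> \<le> \<bar>x - y\<bar> / 2" using a by (intro divide_left_mono) auto
  finally show "dist (hcurve s r x) (hcurve s r y) \<le> 1/2 * dist x y" by (simp add: dist_real_def)
qed simp

lemma strip_curves_hcurve: "s \<in> {- 1, 1} \<Longrightarrow> strip_curves R (1/2) (hcurve s (- R)) (hcurve s R)"
  unfolding strip_curves_def using R_pos a
  by (auto intro!: strip_curve_hcurve) (auto simp: hcurve_def divide_strict_right_mono)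

lemma strip_curves_vcurve: "s \<in> {- 1, 1} \<Longrightarrow> strip_curves R (1/2) (vcurve s (- R)) (vcurve s R)"
  using strip_curves_reflect[OF strip_curves_hcurve, of s] by (simp add: vcurve_reflect)

lemma mem_hstrip_hcurve:
  "(x, y) \<in> hstrip R (hcurve s (- R)) (hcurve s R) \<longleftrightarrow>
    x \<in> {-R..R} \<and> s * (1 - x) - R \<le> a * y \<and> a * y \<le> s * (1 - x) + R"
  by (simp add: hstrip_def hcurve_def le_div_a)

lemma mem_vstrip_vcurve:
  "(x, y) \<in> vstrip R (vcurve s (- R)) (vcurve s R) \<longleftrightarrow>
    y \<in> {-R..R} \<and> - s * (1 + y) - R \<le> a * x \<and> a * x \<le> - s * (1 + y) + R"
  by (simp add: vstrip_def vcurve_def le_div_a)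

text \<open>Since \<open>R < 1/2\<close>, the quantity \<open>1 + y - R\<close> is positive and the
  strip stays on one side of the line \<open>x = 0\<close>. There \<open>\<bar>x\<bar>\<close> is
  linear and the map is affine.\<close>

lemma vstrip_vcurve_bounds:
  assumes s: "s \<in> {- 1, 1}" and "(x, y) \<in> vstrip R (vcurve s (- R)) (vcurve s R)"
  shows "x \<in> {-R..R}" "s * x < 0" "\<bar>x\<bar> = - s * x"
proof -
  have y: "y \<in> {-R..R}" and x: "vcurve s (- R) y \<le> x" "x \<le> vcurve s R y"
    using assms(2) by (auto simp: vstrip_def)
  have "vcurve s (- R) y \<in> {-R..R}" "vcurve s R y \<in> {-R..R}"
    using strip_curves_vcurve[OF s] y unfolding strip_curves_def strip_curve_def by blast+
  then show "x \<in> {-R..R}" using x by auto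
  have "a * (s * x) < 0"
    using assms R_less unfolding mem_vstrip_vcurve by (auto simp: algebra_simps)
  then show "s * x < 0" using a by (simp add: mult_less_0_iff)
  then show "\<bar>x\<bar> = - s * x" using s by auto
qed

lemma hstrip_hcurve_bounds:
  assumes s: "s \<in> {- 1, 1}" and "(x, y) \<in> hstrip R (hcurve s (- R)) (hcurve s R)"
  shows "y \<in> {-R..R}" "0 < s * y" "\<bar>y\<bar> = s * y"
proof -
  have "(- y, - x) \<in> vstrip R (vcurve s (- R)) (vcurve s R)"
    using assms(2) by (auto simp: mem_hstrip_hcurve mem_vstrip_vcurve algebra_simps)
  then show "y \<in> {-R..R}" "0 < s * y" "\<bar>y\<bar> = s * y"
    using vstrip_vcurve_bounds[OF s] by fastforce+
qed

text \<open>On the affine branch, the slanted bounds on \<open>a * x\<close> say exactly that the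
  first coordinate of the image lies in \<open>{-R..R}\<close>.\<close>

lemma preimage_strip_eq:
  assumes s: "s \<in> {- 1, 1}"
  shows "preimage_strip s = vstrip R (vcurve s (- R)) (vcurve s R)"
proof -
  have "(x, y) \<in> preimage_strip s \<longleftrightarrow> (x, y) \<in> vstrip R (vcurve s (- R)) (vcurve s R)" for x y
  proof
    assume "(x, y) \<in> preimage_strip s"
    then show "(x, y) \<in> vstrip R (vcurve s (- R)) (vcurve s R)"
      using s by (auto simp: preimage_strip_def lozi_def mem_vstrip_vcurve)
  next
    assume *: "(x, y) \<in> vstrip R (vcurve s (- R)) (vcurve s R)"
    have "a * \<bar>x\<bar> = - s * (a * x)" by (simp add: vstrip_vcurve_bounds(3)[OF s *])
    then show "(x, y) \<in> preimage_strip s"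
      using vstrip_vcurve_bounds(1,2)[OF s *] * s by (auto simp: preimage_strip_def lozi_def mem_vstrip_vcurve)
  qed
  then show ?thesis by auto
qed

text \<open>The affine branch exchanges the two kinds of inequalities: the range of \<open>y\<close>
  becomes the slanted bounds of the image strip, and the slanted bounds on \<open>x\<close> become
  the range of the new first coordinate.\<close>

lemma image_strip_eq:
  assumes s: "s \<in> {- 1, 1}"
  shows "image_strip s = hstrip R (hcurve s (- R)) (hcurve s R)"
  unfolding image_preimage_strip[symmetric] preimage_strip_eq[OF s]
proof (rule image_lozi_eqI)
  fix x y
  show "lozi a (x, y) \<in> hstrip R (hcurve s (- R)) (hcurve s R) \<longleftrightarrow>
    (x, y) \<in> vstrip R (vcurve s (- R)) (vcurve s R)" (is "?l \<longleftrightarrow> ?r")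
  proof
    assume r: ?r
    then have "a * \<bar>x\<bar> = - s * (a * x)" by (simp add: vstrip_vcurve_bounds(3)[OF s])
    then show ?l
      using r s by (auto simp: lozi_def mem_hstrip_hcurve mem_vstrip_vcurve)
  next
    assume l: ?l
    then have "a * \<bar>x\<bar> = - s * (a * x)"
      using hstrip_hcurve_bounds(3)[OF s, of _ "- x"] by (simp add: lozi_def)
    then show ?r
      using l hstrip_hcurve_bounds(1,2)[OF s l[unfolded lozi_def, simplified]] s
      by (auto simp: lozi_def mem_hstrip_hcurve mem_vstrip_vcurve)
  qed
qed

lemma continuous_on_lozi: "continuous_on A (lozi a)"
  unfolding lozi_def case_prod_unfold by (intro continuous_intros)

lemma continuous_on_inv_lozi: "continuous_on A (inv (lozi a))"
  unfolding inv_lozi case_prod_unfold by (intro continuous_intros)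

lemma homeomorphic_lozi_strips:
  "homeomorphic_map (top_of_set (preimage_strip s)) (top_of_set (image_strip s)) (lozi a)"
  unfolding homeomorphic_map_maps homeomorphic_maps_def
proof (intro exI[of _ "inv (lozi a)"] conjI ballI)
  show "continuous_map (top_of_set (preimage_strip s)) (top_of_set (image_strip s)) (lozi a)"
    by (simp add: continuous_map_in_subtopology image_subset_iff_funcset[symmetric]
        continuous_on_lozi image_preimage_strip)
  have "inv (lozi a) ` image_strip s = preimage_strip s"
    by (simp add: image_preimage_strip[symmetric] image_image bij_is_inj[OF bij_lozi])
  then show "continuous_map (top_of_set (image_strip s)) (top_of_set (preimage_strip s)) (inv (lozi a))"
    by (simp add: continuous_map_in_subtopology image_subset_iff_funcset[symmetric] continuous_on_inv_lozi)
qed (simp_all add: bij_is_inj[OF bij_lozi] surj_f_inv_f bij_is_surj[OF bij_lozi])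

text \<open>The image \<open>(x', y')\<close> of a point \<open>(x, y)\<close> of the strip
  satisfies \<open>a * y' = s * (1 - x') + s * y\<close>. So \<open>y = - R\<close> and
  \<open>y = R\<close> go to the two bounding curves, in exchanged order if
  \<open>s = - 1\<close>.\<close>

lemma lozi_hboundary:
  assumes s: "s \<in> {- 1, 1}"
  shows "lozi a ` vstrip_hboundary R (vcurve s (- R)) (vcurve s R) =
    hstrip_hboundary R (hcurve s (- R)) (hcurve s R)"
proof (rule image_lozi_eqI)
  fix x y
  have hb: "(x', y') \<in> hstrip_hboundary R (hcurve s (- R)) (hcurve s R) \<longleftrightarrow>
      (x', y') \<in> image_strip s \<and> (a * y' = s * (1 - x') - R \<or> a * y' = s * (1 - x') + R)" for x' y'
    using R_pos a unfolding image_strip_eq[OF s] mem_hstrip_hcurve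
    by (auto simp: hstrip_hboundary_def hcurve_def le_div_a)
  have ax: "a * \<bar>x\<bar> = - s * (a * x)" if "(x, y) \<in> preimage_strip s"
    using vstrip_vcurve_bounds(3)[OF s that[unfolded preimage_strip_eq[OF s]]] by simp
  show "lozi a (x, y) \<in> hstrip_hboundary R (hcurve s (- R)) (hcurve s R) \<longleftrightarrow>
    (x, y) \<in> vstrip_hboundary R (vcurve s (- R)) (vcurve s R)"
  proof (cases "(x, y) \<in> preimage_strip s")
    case True
    then have "(1 + y - a * \<bar>x\<bar>, - x) \<in> image_strip s"
      using lozi_mem_image_strip[of "(x, y)" s] by (simp add: lozi_def)
    then have "lozi a (x, y) \<in> hstrip_hboundary R (hcurve s (- R)) (hcurve s R) \<longleftrightarrow>
        a * - x = s * (1 - (1 + y - a * \<bar>x\<bar>)) - R \<or> a * - x = s * (1 - (1 + y - a * \<bar>x\<bar>)) + R"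
      by (simp only: lozi_def prod.case hb simp_thms)
    also have "\<dots> \<longleftrightarrow> y = - R \<or> y = R"
      using s unfolding ax[OF True] by auto
    also have "\<dots> \<longleftrightarrow> (x, y) \<in> vstrip_hboundary R (vcurve s (- R)) (vcurve s R)"
      using True by (simp add: vstrip_hboundary_def preimage_strip_eq[OF s, symmetric])
    finally show ?thesis .
  next
    case False
    then show ?thesis
      using lozi_mem_image_strip[of "(x, y)" s]
      by (simp add: lozi_def hb vstrip_hboundary_def preimage_strip_eq[OF s, symmetric])
  qed
qed

text \<open>With \<open>x'\<close> the first coordinate of the image,
  \<open>a * x = - s * (1 + y) + s * x'\<close>, so the bounding curves correspond to
  \<open>x' = - R\<close> and \<open>x' = R\<close>.\<close>

lemma lozi_vboundary:
  assumes s: "s \<in> {- 1, 1}"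
  shows "lozi a ` vstrip_vboundary R (vcurve s (- R)) (vcurve s R) =
    hstrip_vboundary R (hcurve s (- R)) (hcurve s R)"
proof (rule image_lozi_eqI)
  fix x y
  have vb: "(x, y) \<in> vstrip_vboundary R (vcurve s (- R)) (vcurve s R) \<longleftrightarrow>
      (x, y) \<in> preimage_strip s \<and> (a * x = - s * (1 + y) - R \<or> a * x = - s * (1 + y) + R)"
    using R_pos a unfolding preimage_strip_eq[OF s] mem_vstrip_vcurve
    by (auto simp: vstrip_vboundary_def vcurve_def le_div_a)
  have ax: "a * \<bar>x\<bar> = - s * (a * x)" if "(x, y) \<in> preimage_strip s"
    using vstrip_vcurve_bounds(3)[OF s that[unfolded preimage_strip_eq[OF s]]] by simp
  show "lozi a (x, y) \<in> hstrip_vboundary R (hcurve s (- R)) (hcurve s R) \<longleftrightarrow>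
    (x, y) \<in> vstrip_vboundary R (vcurve s (- R)) (vcurve s R)"
  proof (cases "(x, y) \<in> preimage_strip s")
    case True
    then have "(1 + y - a * \<bar>x\<bar>, - x) \<in> image_strip s"
      using lozi_mem_image_strip[of "(x, y)" s] by (simp add: lozi_def)
    then have "lozi a (x, y) \<in> hstrip_vboundary R (hcurve s (- R)) (hcurve s R) \<longleftrightarrow>
        1 + y - a * \<bar>x\<bar> = - R \<or> 1 + y - a * \<bar>x\<bar> = R"
      by (simp add: lozi_def hstrip_vboundary_def image_strip_eq[OF s, symmetric])
    also have "\<dots> \<longleftrightarrow> a * x = - s * (1 + y) - R \<or> a * x = - s * (1 + y) + R"
      using s unfolding ax[OF True] by auto
    also have "\<dots> \<longleftrightarrow> (x, y) \<in> vstrip_vboundary R (vcurve s (- R)) (vcurve s R)"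
      using True by (simp only: vb simp_thms)
    finally show ?thesis .
  next
    case False
    then show ?thesis
      using lozi_mem_image_strip[of "(x, y)" s]
      by (simp add: lozi_def vb hstrip_vboundary_def image_strip_eq[OF s, symmetric])
  qed
qed

section \<open>The Conley-Moser conditions\<close>

text \<open>The value 1/2 serves for all four constants: the bounding lines have slopes below 1/4 in
  absolute value, and the argument for image strips gives 2/7 both for the slopes and for the ratio
  of the widths.\<close>

lemma conley_moser_lozi:
  assumes H: "H 1 = image_strip 1" "H 2 = image_strip (- 1)"
    and V: "V 1 = preimage_strip 1" "V 2 = preimage_strip (- 1)"
  shows "horizontal_strip R (1/2) (H 1)" "horizontal_strip R (1/2) (H 2)" "H 1 \<inter> H 2 = {}"
    "vertical_strip R (1/2) (V 1)" "vertical_strip R (1/2) (V 2)" "V 1 \<inter> V 2 = {}"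
    "conley_moser1 (lozi a) R (1/2) (1/2) H V"
    "conley_moser2 (lozi a) R (1/2) (1/2) (1/2) (1/2) H V"
proof -
  have ex: "\<exists>s\<in>{- 1, 1}. H i = image_strip s \<and> V i = preimage_strip s" if "i \<in> {1, 2}" for i
    using that H V by auto
  show "H 1 \<inter> H 2 = {}" "V 1 \<inter> V 2 = {}"
    unfolding H V image_strip_def preimage_strip_def by auto
  have hor: "horizontal_strip R (1/2) (image_strip s)" and ver: "vertical_strip R (1/2) (preimage_strip s)"
    if "s \<in> {- 1, 1}" for s
    unfolding horizontal_strip_def vertical_strip_def
    using strip_curves_hcurve[OF that] image_strip_eq[OF that]
      strip_curves_vcurve[OF that] preimage_strip_eq[OF that] by blast+
  then show "horizontal_strip R (1/2) (H 1)" "horizontal_strip R (1/2) (H 2)"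
    "vertical_strip R (1/2) (V 1)" "vertical_strip R (1/2) (V 2)"
    unfolding H V by simp_all
  show "conley_moser1 (lozi a) R (1/2) (1/2) H V"
    unfolding conley_moser1_def
  proof (intro conjI ballI)
    fix i :: nat assume "i \<in> {1, 2}"
    then obtain s where s: "s \<in> {- 1, 1}" and eq: "H i = image_strip s" "V i = preimage_strip s"
      using ex by blast
    show "homeomorphic_map (top_of_set (V i)) (top_of_set (H i)) (lozi a)"
      unfolding eq by (rule homeomorphic_lozi_strips)
    show "\<exists>h1 h2 v1 v2.
           strip_curves R (1/2) h1 h2 \<and> H i = hstrip R h1 h2 \<and>
           strip_curves R (1/2) v1 v2 \<and> V i = vstrip R v1 v2 \<and>
           lozi a ` vstrip_hboundary R v1 v2 = hstrip_hboundary R h1 h2 \<and>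
           lozi a ` vstrip_vboundary R v1 v2 = hstrip_vboundary R h1 h2"
      using strip_curves_hcurve[OF s] strip_curves_vcurve[OF s] image_strip_eq[OF s] preimage_strip_eq[OF s]
        lozi_hboundary[OF s] lozi_vboundary[OF s] unfolding eq by blast
  qed auto
  show "conley_moser2 (lozi a) R (1/2) (1/2) (1/2) (1/2) H V"
    unfolding conley_moser2_def
  proof (intro conjI allI impI ballI)
    fix h1 h2 and i :: nat
    assume "strip_curves R (1/2) h1 h2 \<and> hstrip R h1 h2 \<subseteq> (\<Union>i\<in>{1, 2}. H i)" and "i \<in> {1, 2}"
    then obtain s where h: "strip_curves R (1/2) h1 h2" and s: "s \<in> {- 1, 1}"
      and eq: "H i = image_strip s" using ex by blast
    have "hstrip R h1 h2 \<subseteq> square"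
      \<comment> \<open>The image of a strip in the square lies in the image of the square, so
        intersecting with \<open>H i\<close> only cuts out a half of the square.\<close>
      using h by (fastforce simp: strip_curves_def strip_curve_def hstrip_def)
    then have "lozi a ` hstrip R h1 h2 \<inter> H i =
      lozi a ` hstrip R h1 h2 \<inter> {p \<in> square. 0 < s * snd p}"
      unfolding eq image_strip_def by blast
    then show "\<exists>g1 g2. strip_curves R (1/2) g1 g2 \<and>
      lozi a ` hstrip R h1 h2 \<inter> H i = hstrip R g1 g2 \<and>
      strip_width R g1 g2 \<le> 1/2 * strip_width R h1 h2"
      by - (rule hstrip_image[OF h s], auto)
  next
    fix v1 v2 and i :: nat
    assume "strip_curves R (1/2) v1 v2 \<and> vstrip R v1 v2 \<subseteq> (\<Union>i\<in>{1, 2}. V i)" and "i \<in> {1, 2}"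
    then obtain s where v: "strip_curves R (1/2) v1 v2" and s: "s \<in> {- 1, 1}"
      and eq: "V i = preimage_strip s" using ex by blast
    have "vstrip R v1 v2 \<subseteq> square"
      using v by (fastforce simp: strip_curves_def strip_curve_def vstrip_def)
    then have "lozi a -` vstrip R v1 v2 \<inter> V i =
      lozi a -` vstrip R v1 v2 \<inter> {p \<in> square. s * fst p < 0}"
      unfolding eq preimage_strip_def by blast
    then show "\<exists>w1 w2. strip_curves R (1/2) w1 w2 \<and>
      lozi a -` vstrip R v1 v2 \<inter> V i = vstrip R w1 w2 \<and>
      strip_width R w1 w2 \<le> 1/2 * strip_width R v1 v2"
      by - (rule vstrip_vimage[OF v s], auto)
  qed auto
qed

end

subsection \<open>Orbits\<close>

definition iter :: "('a \<Rightarrow> 'a) \<Rightarrow> int \<Rightarrow> 'a \<Rightarrow> 'a" where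
  "iter f k = (if 0 \<le> k then f ^^ nat k else inv f ^^ nat (- k))"

lemma iter_0 [simp]: "iter f 0 p = p"
  by (simp add: iter_def)

lemma iter_add_1:
  assumes "bij f"
  shows "iter f (k + 1) p = f (iter f k p)"
proof (cases "0 \<le> k")
  case True
  then have "nat (k + 1) = Suc (nat k)" by simp
  with True show ?thesis by (simp add: iter_def)
next
  case False
  \<comment> \<open>At \<open>k = - 1\<close> the exponent \<open>k + 1\<close> falls into the other
    branch of \<open>iter\<close>.\<close>
  then have "nat (- k) = Suc (nat (- k - 1))" by simp
  with False show ?thesis
    using surj_f_inv_f[OF bij_is_surj[OF assms]] by (cases "k = - 1") (auto simp: iter_def)
qed

text \<open>Induction in both directions from 0; downwards, injectivity cancels one application of
  \<open>f\<close>.\<close>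

lemma iter_unique:
  assumes "bij f" "\<And>k. q (k + 1) = f (q k)"
  shows "iter f k (q 0) = q k"
proof (induction k rule: int_induct[where k = 0])
  case (step1 i)
  then show ?case using assms by (simp add: iter_add_1)
next
  case (step2 i)
  have "f (iter f (i - 1) (q 0)) = f (q (i - 1))"
    using step2 assms(2)[of "i - 1"] iter_add_1[OF assms(1), of "i - 1"] by simp
  then show ?case using assms(1) by (simp add: bij_is_inj inj_eq)
qed simp

lemma continuous_on_iter:
  assumes "continuous_on UNIV f" "continuous_on UNIV (inv f)"
  shows "continuous_on UNIV (iter f k)"
proof -
  have "continuous_on UNIV (g ^^ n)" if "continuous_on UNIV g" for g :: "'a \<Rightarrow> 'a" and n
  proof (induction n)
    case (Suc n)
    then show ?case
      unfolding funpow.simps by (rule continuous_on_compose) (rule continuous_on_subset[OF that subset_UNIV])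
  qed (simp add: id_def)
  then show ?thesis using assms by (simp add: iter_def)
qed

context lozi_horseshoe
begin

section \<open>Orbits as solutions of a second-order recursion\<close>

definition orb :: "real \<times> real \<Rightarrow> int \<Rightarrow> real" where
  "orb p k = fst (iter (lozi a) k p)"

lemma iter_lozi: "iter (lozi a) k p = (orb p k, - orb p (k - 1))"
  using iter_add_1[OF bij_lozi, of a "k - 1" p]
  by (simp add: orb_def lozi_def prod_eq_iff split: prod.splits)

lemma orb_rec: "orb p (k + 1) = 1 - orb p (k - 1) - a * \<bar>orb p k\<bar>"
proof -
  have "orb p (k + 1) = fst (lozi a (orb p k, - orb p (k - 1)))"
    unfolding iter_lozi[symmetric] by (simp add: orb_def iter_add_1[OF bij_lozi])
  then show ?thesis by (simp add: lozi_def)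
qed

lemma orb_eq: "p = (orb p 0, - orb p (- 1))"
  using iter_lozi[of 0 p] by simp

lemma orb_unique:
  assumes "\<And>k. x (k + 1) = 1 - x (k - 1) - a * \<bar>x k\<bar>"
  shows "orb (x 0, - x (- 1)) = x"
proof
  fix k
  have "iter (lozi a) k ((\<lambda>k. (x k, - x (k - 1))) 0) = (\<lambda>k. (x k, - x (k - 1))) k"
    by (rule iter_unique[OF bij_lozi]) (simp add: lozi_def assms)
  then show "orb (x 0, - x (- 1)) k = x k" by (simp add: orb_def)
qed

lemma orb_lozi: "orb (lozi a p) k = orb p (k + 1)"
proof -
  have "iter (lozi a) k ((\<lambda>k. iter (lozi a) (k + 1) p) 0) = (\<lambda>k. iter (lozi a) (k + 1) p) k"
    by (rule iter_unique[OF bij_lozi]) (rule iter_add_1[OF bij_lozi])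
  moreover have "iter (lozi a) 1 p = lozi a p"
    using iter_add_1[OF bij_lozi, of a 0 p] by simp
  ultimately show ?thesis by (simp add: orb_def)
qed

lemma continuous_on_orb: "continuous_on A (\<lambda>p. orb p k)"
  unfolding orb_def
  by (intro continuous_on_fst continuous_on_subset[OF continuous_on_iter subset_UNIV]
      continuous_on_lozi continuous_on_inv_lozi)

text \<open>Second coordinates are negated earlier first coordinates, so these are the points whose
  two-sided orbit stays in the square: its largest invariant subset.\<close>

definition saddle :: "(real \<times> real) set" where
  "saddle = {p. \<forall>k. \<bar>orb p k\<bar> \<le> R}"

lemma saddle_subset: "saddle \<subseteq> square"
proof
  fix p assume "p \<in> saddle"
  then have "\<bar>orb p 0\<bar> \<le> R" "\<bar>orb p (- 1)\<bar> \<le> R" by (auto simp: saddle_def)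
  then have "(orb p 0, - orb p (- 1)) \<in> square" by auto
  then show "p \<in> square" using orb_eq[of p] by simp
qed

lemma compact_saddle: "compact saddle"
proof -
  have "saddle = square \<inter> (\<Inter>k. {p. \<bar>orb p k\<bar> \<le> R})"
    using saddle_subset by (auto simp: saddle_def)
  moreover have "closed (\<Inter>k. {p. \<bar>orb p k\<bar> \<le> R})"
    by (intro closed_INT ballI closed_Collect_le continuous_on_orb continuous_intros)
  ultimately show ?thesis
    by (simp add: compact_Int_closed compact_Times)
qed

lemma lozi_saddle_iff: "lozi a p \<in> saddle \<longleftrightarrow> p \<in> saddle"
  unfolding saddle_def mem_Collect_eq orb_lozi by (metis diff_add_cancel)

lemma image_saddle: "lozi a ` saddle = saddle"
  by (rule image_lozi_eqI) (rule lozi_saddle_iff)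

lemma inv_lozi_saddle: "p \<in> saddle \<Longrightarrow> inv (lozi a) p \<in> saddle"
  using lozi_saddle_iff[of "inv (lozi a) p"] by (simp add: surj_f_inv_f[OF bij_is_surj[OF bij_lozi]])

text \<open>A zero entry would force its two neighbours to add up to 1, but each is at most
  \<open>R < 1/2\<close>.\<close>

lemma orb_nonzero: "p \<in> saddle \<Longrightarrow> orb p k \<noteq> 0"
proof
  assume "p \<in> saddle" "orb p k = 0"
  then have "\<bar>orb p (k + 1)\<bar> \<le> R" "\<bar>orb p (k - 1)\<bar> \<le> R" by (auto simp: saddle_def)
  moreover have "orb p (k + 1) + orb p (k - 1) = 1"
    using orb_rec[of p k] \<open>orb p k = 0\<close> by simp
  ultimately show False using R_less by linarith
qed

lemma fst_saddle: "p \<in> saddle \<Longrightarrow> fst p \<noteq> 0"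
  using orb_nonzero[of p 0] by (simp add: orb_def)

lemma snd_saddle: "p \<in> saddle \<Longrightarrow> snd p \<noteq> 0"
  using orb_nonzero[of p "- 1"] orb_eq[of p] by (metis neg_equal_0_iff_equal snd_conv)

section \<open>Symbolic coding\<close>

text \<open>Symbol 1 means a negative first coordinate, in accordance with \<open>V 1\<close> lying
  in \<open>x < 0\<close>.\<close>

definition sign_of :: "nat \<Rightarrow> real" where
  "sign_of i = (if i = 1 then - 1 else 1)"

definition itinerary :: "real \<times> real \<Rightarrow> int \<Rightarrow> nat" where
  "itinerary p k = (if orb p k < 0 then 1 else 2)"

lemma abs_sign_of: "\<bar>sign_of i\<bar> = 1"
  by (simp add: sign_of_def)

lemma itinerary_lozi: "itinerary (lozi a p) = shift (itinerary p)"
  by (auto simp: itinerary_def shift_def orb_lozi)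

lemma orb_sign_rec: "orb p k = sign_of (itinerary p k) * (1 - orb p (k + 1) - orb p (k - 1)) / a"
proof -
  have "1 - orb p (k + 1) - orb p (k - 1) = a * \<bar>orb p k\<bar>"
    using orb_rec[of p k] by simp
  then show ?thesis using a by (simp add: sign_of_def itinerary_def)
qed

lemma sign_step_contraction:
  assumes "\<bar>e\<bar> = 1" "\<bar>x - x'\<bar> \<le> d" "\<bar>y - y'\<bar> \<le> d"
  shows "\<bar>e * (1 - x - y) / a - e * (1 - x' - y') / a\<bar> \<le> 1/2 * d"
proof -
  have "e * (1 - x - y) / a - e * (1 - x' - y') / a = e * ((x' - x) + (y' - y)) / a"
    by (simp add: diff_divide_distrib[symmetric] algebra_simps)
  also have "\<bar>\<dots>\<bar> = \<bar>(x' - x) + (y' - y)\<bar> / a"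
    using a assms(1) by (simp add: abs_mult)
  also have "\<dots> \<le> (2 * d) / 4"
    using a assms by (intro frac_le) auto
  finally show ?thesis by simp
qed

text \<open>Each use of the recursion halves the difference but looks one place to either side, so
  the window loses one place at both ends. The start is \<open>2 * R < 1\<close>.\<close>

lemma orb_agree:
  assumes p: "p \<in> saddle" and q: "q \<in> saddle"
    and agree: "\<And>k. \<bar>k\<bar> < int n \<Longrightarrow> itinerary p k = itinerary q k"
    and "j \<le> n" "\<bar>k\<bar> \<le> int n - int j"
  shows "\<bar>orb p k - orb q k\<bar> \<le> (1/2) ^ j"
  using assms(4,5)
proof (induction j arbitrary: k)
  case 0
  have "\<bar>orb p k\<bar> \<le> R" "\<bar>orb q k\<bar> \<le> R" using p q by (auto simp: saddle_def)
  then show ?case using R_less by simp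
next
  case (Suc j)
  have "\<bar>orb p (k + 1) - orb q (k + 1)\<bar> \<le> (1/2) ^ j" "\<bar>orb p (k - 1) - orb q (k - 1)\<bar> \<le> (1/2) ^ j"
    using Suc.prems by (auto intro!: Suc.IH)
  moreover have "itinerary p k = itinerary q k" using Suc.prems by (intro agree) simp
  ultimately show ?case
    unfolding orb_sign_rec[of p k] orb_sign_rec[of q k] power_Suc
    by (simp only: sign_step_contraction abs_sign_of)
qed

text \<open>A point is made of the entries at 0 and - 1. The window has size \<open>Suc n\<close> so
  that \<open>n\<close> halvings still reach the entry at - 1.\<close>

lemma dist_agree:
  assumes "p \<in> saddle" "q \<in> saddle"
    and "\<And>k. \<bar>k\<bar> < int (Suc n) \<Longrightarrow> itinerary p k = itinerary q k"
  shows "dist p q \<le> 2 * (1/2) ^ n"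
proof -
  have "\<bar>orb p 0 - orb q 0\<bar> \<le> (1/2) ^ n" "\<bar>orb p (- 1) - orb q (- 1)\<bar> \<le> (1/2) ^ n"
    by (rule orb_agree[OF assms, where n = "Suc n"]; simp)+
  moreover have "dist p q \<le> dist (fst p) (fst q) + dist (snd p) (snd q)"
    by (simp add: dist_prod_def sqrt_sum_squares_le_sum)
  moreover have "dist (fst p) (fst q) = \<bar>orb p 0 - orb q 0\<bar>"
    "dist (snd p) (snd q) = \<bar>orb p (- 1) - orb q (- 1)\<bar>"
    by (subst orb_eq[of p], subst orb_eq[of q], simp add: dist_real_def abs_minus_commute)+
  ultimately show ?thesis by linarith
qed

lemma half_power_small:
  assumes "0 < e" obtains n where "2 * (1/2) ^ n < (e :: real)"
proof -
  obtain n where "(1/2) ^ n < e / 2" using real_arch_pow_inv[of "e / 2" "1/2"] assms by auto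
  then show thesis using that[of n] by simp
qed

lemma inj_on_itinerary: "inj_on itinerary saddle"
proof (rule inj_onI, rule ccontr)
  fix p q assume pq: "p \<in> saddle" "q \<in> saddle" "itinerary p = itinerary q" "p \<noteq> q"
  then obtain n where "2 * (1/2) ^ n < dist p q"
    using half_power_small[of "dist p q"] by auto
  then show False using dist_agree[OF pq(1,2), of n] pq(3) by simp
qed

text \<open>The contraction yields a bounded sequence solving the equations with prescribed signs.
  As \<open>1 - x (k + 1) - x (k - 1)\<close> is positive, its entries do have these signs, and the
  equations become the recursion with \<open>\<bar>x k\<bar>\<close>.\<close>

lemma itinerary_surj:
  assumes s: "\<And>k. s k \<in> {1, 2}"
  obtains p where "p \<in> saddle" "itinerary p = s"
proof -
  let ?\<Phi> = "\<lambda>x k. sign_of (s k) * (1 - x (k + 1) - x (k - 1)) / a"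
  have abs\<Phi>: "\<bar>?\<Phi> x k\<bar> = \<bar>1 - x (k + 1) - x (k - 1)\<bar> / a" for x k
    using a by (simp add: abs_mult abs_sign_of)
  obtain x where xR: "\<And>k. \<bar>x k\<bar> \<le> R" and x: "?\<Phi> x = x"
  proof (rule bounded_contraction_fixpoint[of "1/2" R ?\<Phi>])
    fix x :: "int \<Rightarrow> real" and k assume x: "\<And>q. \<bar>x q\<bar> \<le> R"
    have "\<bar>1 - x (k + 1) - x (k - 1)\<bar> \<le> a * R"
      using x[of "k + 1"] x[of "k - 1"] aR by linarith
    then show "\<bar>?\<Phi> x k\<bar> \<le> R"
      unfolding abs\<Phi> le_div_a .
  next
    fix x y :: "int \<Rightarrow> real" and d k assume "\<And>q. \<bar>x q - y q\<bar> \<le> d"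
    then show "\<bar>?\<Phi> x k - ?\<Phi> y k\<bar> \<le> 1/2 * d"
      by (intro sign_step_contraction abs_sign_of)
  qed (use R_pos in auto)
  have pos: "0 < 1 - x (k + 1) - x (k - 1)" for k
    using xR[of "k + 1"] xR[of "k - 1"] R_less by linarith
  have xk: "sign_of (s k) * (1 - x (k + 1) - x (k - 1)) / a = x k" for k
    using fun_cong[OF x, of k] by simp
  have "a * \<bar>x k\<bar> = 1 - x (k + 1) - x (k - 1)" for k
    using pos[of k] abs\<Phi>[where x = x and k = k] a unfolding xk by simp
  then have orb: "orb (x 0, - x (- 1)) = x"
    by (intro orb_unique) (simp add: algebra_simps)
  show thesis
  proof
    show "(x 0, - x (- 1)) \<in> saddle" using xR by (simp add: saddle_def orb)
    have "x k < 0 \<longleftrightarrow> s k = 1" for k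
      using pos[of k] a unfolding xk[of k, symmetric]
      by (auto simp: sign_of_def divide_less_0_iff)
    then show "itinerary (x 0, - x (- 1)) = s"
      using s by (force simp: itinerary_def orb)
  qed
qed

lemma topspace_shift: "topspace full_shift_space = {s. \<forall>k. s k \<in> {1, 2}}"
  by (auto simp: full_shift_space_def PiE_UNIV_domain)

lemma itinerary_image: "itinerary ` saddle = topspace full_shift_space"
proof
  show "itinerary ` saddle \<subseteq> topspace full_shift_space"
    by (auto simp: topspace_shift itinerary_def split: if_splits)
  show "topspace full_shift_space \<subseteq> itinerary ` saddle"
  proof
    fix s assume "s \<in> topspace full_shift_space"
    then have "\<And>k. s k \<in> {1, 2}" by (auto simp: topspace_shift)
    then show "s \<in> itinerary ` saddle" by (metis itinerary_surj imageI)
  qed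
qed

text \<open>It suffices that each symbol is locally constant. Entries never vanish on the saddle, so
  both sign conditions are relatively open.\<close>

lemma continuous_map_itinerary: "continuous_map (top_of_set saddle) full_shift_space itinerary"
  unfolding full_shift_space_def continuous_map_componentwise_UNIV
proof
  fix k
  have neg: "openin (top_of_set saddle) (saddle \<inter> {p. orb p k < 0})"
    by (intro openin_open_Int open_Collect_less continuous_on_orb continuous_intros)
  have pos: "openin (top_of_set saddle) (saddle \<inter> {p. 0 < orb p k})"
    by (intro openin_open_Int open_Collect_less continuous_on_orb continuous_intros)
  show "continuous_map (top_of_set saddle) (discrete_topology {1, 2}) (\<lambda>p. itinerary p k)"
    unfolding continuous_map_def
  proof (intro conjI allI impI)
    fix U
    have "{p \<in> topspace (top_of_set saddle). itinerary p k \<in> U} =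
      (if 1 \<in> U then saddle \<inter> {p. orb p k < 0} else {}) \<union>
      (if 2 \<in> U then saddle \<inter> {p. 0 < orb p k} else {})"
      using orb_nonzero[of _ k] by (auto simp: itinerary_def not_less less_le split: if_splits)
    then show "openin (top_of_set saddle) {p \<in> topspace (top_of_set saddle). itinerary p k \<in> U}"
      using neg pos by auto
  qed (auto simp: itinerary_def)
qed

lemma homeomorphic_itinerary: "homeomorphic_map (top_of_set saddle) full_shift_space itinerary"
proof (rule continuous_imp_homeomorphic_map[OF continuous_map_itinerary])
  show "compact_space (top_of_set saddle)"
    using compact_saddle by (simp add: compact_space_subtopology)
  show "Hausdorff_space full_shift_space"
    by (simp add: full_shift_space_def Hausdorff_space_product_topology)
qed (simp_all add: itinerary_image inj_on_itinerary)

section \<open>The saddle as a Cantor set\<close>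

lemma cantor_saddle: "cantor_set saddle"
  unfolding cantor_set_def
proof (intro conjI ballI)
  show "saddle \<noteq> {}" using itinerary_surj[of "\<lambda>_. 1"] by auto
  show "compact saddle" by (rule compact_saddle)
  fix p assume p: "p \<in> saddle"
  show "p islimpt saddle"
    unfolding islimpt_approachable
  proof (intro allI impI)
    fix e :: real assume "0 < e"
    then obtain n where n: "2 * (1/2) ^ n < e" by (rule half_power_small)
    \<comment> \<open>Changing one symbol just outside the window gives another point closer than
      \<open>e\<close>; \<open>3 - i\<close> exchanges the symbols 1 and 2.\<close>
    define s where "s = (itinerary p)(int (Suc n) := 3 - itinerary p (int (Suc n)))"
    have "s k \<in> {1, 2}" for k by (auto simp: s_def itinerary_def)
    then obtain q where q: "q \<in> saddle" "itinerary q = s" using itinerary_surj[of s] by blast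
    have "itinerary q (int (Suc n)) \<noteq> itinerary p (int (Suc n))"
      unfolding q s_def by (simp add: itinerary_def)
    then have "q \<noteq> p" by auto
    moreover have "dist q p < e"
    proof -
      have "itinerary q k = itinerary p k" if "\<bar>k\<bar> < int (Suc n)" for k
        using that by (auto simp: q(2) s_def)
      then show ?thesis using dist_agree[OF q(1) p, of n] n by fastforce
    qed
    ultimately show "\<exists>q\<in>saddle. q \<noteq> p \<and> dist q p < e" using q(1) by blast
  qed
  show "connected_component_set saddle p = {p}"
  proof (intro equalityI subsetI)
    fix q assume q: "q \<in> connected_component_set saddle p"
    let ?C = "connected_component_set saddle p"
    have C: "?C \<subseteq> saddle" by (rule connected_component_subset)
    \<comment> \<open>A continuous function without zeros keeps its sign on a connected set, so a
      component has a single itinerary.\<close>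
    have "itinerary q k = itinerary p k" for k
    proof (rule ccontr)
      assume ne: "itinerary q k \<noteq> itinerary p k"
      have conn: "connected ((\<lambda>p. orb p k) ` ?C)"
        by (intro connected_continuous_image continuous_on_orb connected_connected_component)
      have "orb p k \<in> (\<lambda>p. orb p k) ` ?C" "orb q k \<in> (\<lambda>p. orb p k) ` ?C"
        using p q by auto
      then have "0 \<in> (\<lambda>p. orb p k) ` ?C"
        using connectedD_interval[OF conn, of "orb p k" "orb q k" 0]
          connectedD_interval[OF conn, of "orb q k" "orb p k" 0] ne
        by (fastforce simp: itinerary_def split: if_splits)
      then show False using C orb_nonzero by (metis imageE subsetD)
    qed
    then show "q \<in> {p}" using inj_on_itinerary C q p by (auto dest!: inj_onD[where x = q and y = p])
  qed (use p in auto)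
qed

end

subsection \<open>Hyperbolicity\<close>

text \<open>Chain rule along the orbit. Growth is measured by \<open>N\<close>, which contracts in
  every single step; the comparison with the norm is paid only once, by the factor
  \<open>C\<close>.\<close>

lemma frechet_derivative_funpow_bound:
  fixes f :: "'a::euclidean_space \<Rightarrow> 'a" and N :: "'a \<Rightarrow> real"
  assumes A: "\<And>p. p \<in> A \<Longrightarrow> f p \<in> A"
    and der: "\<And>p. p \<in> A \<Longrightarrow> (f has_derivative D p) (at p)"
    and E: "\<And>p v. p \<in> A \<Longrightarrow> v \<in> E p \<Longrightarrow> D p v \<in> E (f p)"
    and contr: "\<And>p v. p \<in> A \<Longrightarrow> v \<in> E p \<Longrightarrow> N (D p v) \<le> r * N v"
    and le_N: "\<And>p v. p \<in> A \<Longrightarrow> v \<in> E p \<Longrightarrow> norm v \<le> C * N v"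
    and N_le: "\<And>v. N v \<le> norm v" and "0 \<le> r" "0 \<le> C"
    and p: "p \<in> A" and v: "v \<in> E p"
  shows "norm (frechet_derivative (f ^^ n) (at p) v) \<le> C * r ^ n * norm v"
proof -
  have "\<exists>G. ((f ^^ n) has_derivative G) (at p) \<and> (f ^^ n) p \<in> A \<and> G v \<in> E ((f ^^ n) p) \<and>
      N (G v) \<le> r ^ n * N v"
  proof (induction n)
    case 0
    show ?case using p v by (intro exI[of _ id]) (auto simp: id_def)
  next
    case (Suc n)
    then obtain G where G: "((f ^^ n) has_derivative G) (at p)" "(f ^^ n) p \<in> A"
      "G v \<in> E ((f ^^ n) p)" "N (G v) \<le> r ^ n * N v" by blast
    let ?q = "(f ^^ n) p"
    have "((f \<circ> (f ^^ n)) has_derivative (D ?q \<circ> G)) (at p)"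
      by (rule diff_chain_at[OF G(1) der[OF G(2)]])
    moreover have "N (D ?q (G v)) \<le> r * (r ^ n * N v)"
      using contr[OF G(2,3)] mult_left_mono[OF G(4) \<open>0 \<le> r\<close>] by linarith
    ultimately show ?case
      using A[OF G(2)] E[OF G(2,3)] by (intro exI[of _ "D ?q \<circ> G"]) (auto simp: mult.assoc o_def)
  qed
  then obtain G where G: "((f ^^ n) has_derivative G) (at p)" "(f ^^ n) p \<in> A"
    "G v \<in> E ((f ^^ n) p)" "N (G v) \<le> r ^ n * N v" by blast
  have "norm (G v) \<le> C * N (G v)" by (rule le_N[OF G(2,3)])
  also have "\<dots> \<le> C * (r ^ n * norm v)"
    using G(4) N_le[of v] \<open>0 \<le> r\<close> \<open>0 \<le> C\<close>
    by (intro mult_left_mono order_trans[OF G(4)]) auto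
  finally show ?thesis
    using frechet_derivative_at[OF G(1)] by (simp add: mult.assoc)
qed

context lozi_horseshoe
begin

section \<open>The invariant line fields\<close>

text \<open>Unlike \<open>sgn\<close>, this never vanishes, so the slope equations make sense on the
  whole plane.\<close>

definition pos_sign :: "real \<Rightarrow> real" where
  "pos_sign x = (if x < 0 then - 1 else 1)"

lemma abs_pos_sign: "\<bar>pos_sign x\<bar> = 1"
  by (simp add: pos_sign_def)

text \<open>The denominator is at least \<open>4 - 1/2 = 7/2\<close> in absolute value, so
  \<open>1 / (a * e p - m (T p))\<close> preserves the bound 1/2 on slopes and contracts by
  4/49.\<close>

lemma slope_exists:
  fixes T :: "'p \<Rightarrow> 'p" and e :: "'p \<Rightarrow> real"
  assumes e: "\<And>p. \<bar>e p\<bar> = 1"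
  obtains m where "\<And>p. \<bar>m p\<bar> \<le> 1/2" "\<And>p. m p * (a * e p - m (T p)) = 1"
proof -
  let ?\<Phi> = "\<lambda>m p. 1 / (a * e p - m (T p))"
  have den: "7/2 \<le> \<bar>a * e p - t\<bar>" if "\<bar>t\<bar> \<le> 1/2" for p t
  proof -
    have "\<bar>a * e p\<bar> = a" using a e by (simp add: abs_mult)
    then show ?thesis using that a by linarith
  qed
  obtain m where m: "\<And>p. \<bar>m p\<bar> \<le> 1/2" "?\<Phi> m = m"
  proof (rule bounded_contraction_fixpoint[of "1/2" "1/2" ?\<Phi>])
    fix m :: "'p \<Rightarrow> real" and p assume "\<And>q. \<bar>m q\<bar> \<le> 1/2"
    then have "7/2 \<le> \<bar>a * e p - m (T p)\<bar>" by (intro den)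
    then have "1 / \<bar>a * e p - m (T p)\<bar> \<le> 1 / 2" by (intro divide_left_mono) auto
    then show "\<bar>?\<Phi> m p\<bar> \<le> 1/2" by simp
  next
    fix m m' :: "'p \<Rightarrow> real" and d p
    assume m: "\<And>q. \<bar>m q\<bar> \<le> 1/2" "\<And>q. \<bar>m' q\<bar> \<le> 1/2" and d: "\<And>q. \<bar>m q - m' q\<bar> \<le> d"
    let ?x = "a * e p - m (T p)" and ?y = "a * e p - m' (T p)"
    have x: "7/2 \<le> \<bar>?x\<bar>" and y: "7/2 \<le> \<bar>?y\<bar>" using m by (intro den; simp)+
    then have "?x \<noteq> 0" "?y \<noteq> 0" by auto
    then have "1 / ?x - 1 / ?y = (m (T p) - m' (T p)) / (?x * ?y)"
      by (simp add: diff_frac_eq)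
    then have "\<bar>1 / ?x - 1 / ?y\<bar> = \<bar>m (T p) - m' (T p)\<bar> / (\<bar>?x\<bar> * \<bar>?y\<bar>)"
      by (simp add: abs_mult)
    also have "\<dots> \<le> d / (7/2 * (7/2))"
      using x y d[of "T p"] by (intro frac_le mult_mono) auto
    also have "\<dots> \<le> 1/2 * d" using d[of p] by simp
    finally show "\<bar>?\<Phi> m p - ?\<Phi> m' p\<bar> \<le> 1/2 * d" .
  qed auto
  have "m p * (a * e p - m (T p)) = 1" for p
  proof -
    have "a * e p - m (T p) \<noteq> 0" using den[OF m(1)[of "T p"], of p] by auto
    then show ?thesis using fun_cong[OF m(2), of p] by (simp add: field_simps)
  qed
  then show thesis using that m(1) by blast
qed

definition lozi_deriv :: "real \<Rightarrow> real \<times> real \<Rightarrow> real \<times> real" where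
  "lozi_deriv e = (\<lambda>(u, v). (v - a * e * u, - u))"

definition lozi_deriv_inv :: "real \<Rightarrow> real \<times> real \<Rightarrow> real \<times> real" where
  "lozi_deriv_inv e = (\<lambda>(u, v). (- v, u - a * e * v))"

lemma bounded_linear_lozi_deriv: "bounded_linear (lozi_deriv e)"
  unfolding lozi_deriv_def case_prod_unfold
  by (intro bounded_linear_Pair bounded_linear_sub bounded_linear_minus bounded_linear_fst
      bounded_linear_snd bounded_linear_const_mult)

lemma lozi_deriv_inverse1: "lozi_deriv e (lozi_deriv_inv e w) = w"
  and lozi_deriv_inverse2: "lozi_deriv_inv e (lozi_deriv e w) = w"
  by (auto simp: lozi_deriv_def lozi_deriv_inv_def split: prod.split)

text \<open>On the open half-plane around \<open>p\<close> bounded by the line where the first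
  coordinate is 0, the map agrees with an affine one.\<close>

lemma has_derivative_lozi:
  assumes "fst p \<noteq> 0"
  shows "(lozi a has_derivative lozi_deriv (pos_sign (fst p))) (at p)"
proof -
  let ?e = "pos_sign (fst p)" and ?U = "{q. 0 < pos_sign (fst p) * fst q}"
  have "((\<lambda>q. (1 + snd q - a * (?e * fst q), - fst q)) has_derivative lozi_deriv ?e) (at p)"
    unfolding lozi_deriv_def case_prod_unfold by (auto intro!: derivative_eq_intros simp: mult.assoc)
  then show ?thesis
  proof (rule has_derivative_transform_within_open)
    show "open ?U" by (intro open_Collect_less continuous_intros)
    show "p \<in> ?U" using assms by (auto simp: pos_sign_def)
    show "(1 + snd q - a * (?e * fst q), - fst q) = lozi a q" if "q \<in> ?U" for q
      using that by (auto simp: lozi_def pos_sign_def split: prod.splits if_splits)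
  qed
qed

lemma has_derivative_inv_lozi:
  assumes "snd p \<noteq> 0"
  shows "(inv (lozi a) has_derivative lozi_deriv_inv (pos_sign (- snd p))) (at p)"
proof -
  let ?e = "pos_sign (- snd p)" and ?U = "{q. pos_sign (- snd p) * snd q < 0}"
  have "((\<lambda>q. (- snd q, fst q - a * (?e * snd q) - 1)) has_derivative lozi_deriv_inv ?e) (at p)"
    unfolding lozi_deriv_inv_def case_prod_unfold by (auto intro!: derivative_eq_intros simp: mult.assoc)
  then show ?thesis
  proof (rule has_derivative_transform_within_open)
    show "open ?U" by (intro open_Collect_less continuous_intros)
    show "p \<in> ?U" using assms by (auto simp: pos_sign_def)
    show "(- snd q, fst q - a * (?e * snd q) - 1) = inv (lozi a) q" if "q \<in> ?U" for q
      using that by (auto simp: inv_lozi pos_sign_def split: prod.splits if_splits)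
  qed
qed

lemma neg_snd_eq: "- snd p = fst (inv (lozi a) p)"
  by (simp add: inv_lozi split: prod.split)

lemma hyperbolic_saddle: "hyperbolic_set (lozi a) saddle"
  unfolding hyperbolic_set_def
proof (intro conjI)
  let ?L = "lozi a"
  let ?e = "\<lambda>p :: real \<times> real. pos_sign (fst p)"
  show "bij ?L" by (rule bij_lozi)
  show "compact saddle" by (rule compact_saddle)
  show "?L ` saddle = saddle" by (rule image_saddle)
  show "\<exists>U (f' :: real \<times> real \<Rightarrow> (real \<times> real) \<Rightarrow>\<^sub>L (real \<times> real)).
      open U \<and> saddle \<subseteq> U \<and> continuous_on U f' \<and>
      (\<forall>p\<in>U. (?L has_derivative blinfun_apply (f' p)) (at p) \<and> bij (blinfun_apply (f' p)))"
  proof (intro exI[of _ "{p. fst p < 0} \<union> {p. 0 < fst p}"]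
      exI[of _ "\<lambda>p. Blinfun (lozi_deriv (?e p))"] conjI ballI)
    have op: "open {p :: real \<times> real. fst p < 0}" "open {p :: real \<times> real. 0 < fst p}"
      by (intro open_Collect_less continuous_intros)+
    then show "open ({p :: real \<times> real. fst p < 0} \<union> {p. 0 < fst p})" by blast
    show "saddle \<subseteq> {p. fst p < 0} \<union> {p. 0 < fst p}"
      using fst_saddle by force
    \<comment> \<open>The derivative is constant on each of the two open half-planes.\<close>
    show "continuous_on ({p. fst p < 0} \<union> {p. 0 < fst p}) (\<lambda>p. Blinfun (lozi_deriv (?e p)))"
    proof (rule continuous_on_open_Un[OF op])
      show "continuous_on {p. fst p < 0} (\<lambda>p. Blinfun (lozi_deriv (?e p)))"
        by (rule continuous_on_eq[OF continuous_on_const[of _ "Blinfun (lozi_deriv (- 1))"]])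
          (simp add: pos_sign_def)
      show "continuous_on {p. 0 < fst p} (\<lambda>p. Blinfun (lozi_deriv (?e p)))"
        by (rule continuous_on_eq[OF continuous_on_const[of _ "Blinfun (lozi_deriv 1)"]])
          (simp add: pos_sign_def)
    qed
    fix p :: "real \<times> real" assume "p \<in> {p. fst p < 0} \<union> {p. 0 < fst p}"
    then have p: "fst p \<noteq> 0" by auto
    show "(?L has_derivative blinfun_apply (Blinfun (lozi_deriv (?e p)))) (at p)"
      using has_derivative_lozi[OF p] by (simp add: bounded_linear_Blinfun_apply bounded_linear_lozi_deriv)
    have "bij (lozi_deriv (?e p))"
      by (rule o_bij[of "lozi_deriv_inv (?e p)"]) (auto simp: lozi_deriv_inverse1 lozi_deriv_inverse2)
    then show "bij (blinfun_apply (Blinfun (lozi_deriv (?e p))))"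
      by (simp add: bounded_linear_Blinfun_apply bounded_linear_lozi_deriv)
  qed
  \<comment> \<open>The derivative sends \<open>(1, m p)\<close> to
    \<open>(m p - a * ?e p, - 1)\<close>, so invariance of the unstable lines determines
    \<open>m\<close> at the image from \<open>m p\<close> and the equation looks backwards. For the
    stable lines through \<open>(n p, 1)\<close> it looks forwards.\<close>
  obtain m where m: "\<And>p. \<bar>m p\<bar> \<le> 1/2"
    "\<And>p. m p * (a * ?e (inv ?L p) - m (inv ?L p)) = 1"
    using slope_exists[of "\<lambda>p. ?e (inv ?L p)" "inv ?L"] abs_pos_sign by metis
  obtain n where n: "\<And>p. \<bar>n p\<bar> \<le> 1/2" "\<And>p. n p * (a * ?e p - n (?L p)) = 1"
    using slope_exists[of "\<lambda>p. ?e p" ?L] abs_pos_sign by metis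
  have mL: "m (?L p) * (a * ?e p - m p) = 1" for p
    using m(2)[of "?L p"] by (simp add: inv_f_f[OF bij_is_inj[OF bij_lozi]])
  define Eu where "Eu p = {w. snd w = m p * fst w}" for p
  define Es where "Es p = {w. fst w = n p * snd w}" for p
  \<comment> \<open>Slopes bounded by 1/2 make the two lines transverse.\<close>
  have mn: "m p * n p \<noteq> 1" for p
  proof -
    have "\<bar>m p\<bar> * \<bar>n p\<bar> \<le> 1/2 * (1/2)" using m(1) n(1) by (intro mult_mono) auto
    then show ?thesis by (auto simp flip: abs_mult)
  qed
  have fd: "frechet_derivative ?L (at p) = lozi_deriv (?e p)" if "p \<in> saddle" for p
    using frechet_derivative_at[OF has_derivative_lozi[OF fst_saddle[OF that]]] by simp
  have imgI: "lozi_deriv e ` A = B"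
    if "\<And>w. w \<in> A \<Longrightarrow> lozi_deriv e w \<in> B" "\<And>w. w \<in> B \<Longrightarrow> lozi_deriv_inv e w \<in> A" for e A B
  proof (intro equalityI subsetI)
    fix w assume "w \<in> B"
    then have "lozi_deriv e (lozi_deriv_inv e w) \<in> lozi_deriv e ` A" by (intro imageI that(2))
    then show "w \<in> lozi_deriv e ` A" by (simp add: lozi_deriv_inverse1)
  qed (use that(1) in auto)
  have DEs: "lozi_deriv (?e p) w \<in> Es (?L p)" if "w \<in> Es p" for p w
  proof -
    \<comment> \<open>The slope equation enters as a factor 1, which avoids divisions.\<close>
    have "snd w = (n p * (a * ?e p - n (?L p))) * snd w" using n(2) by simp
    then show ?thesis using that by (simp add: Es_def lozi_deriv_def case_prod_unfold algebra_simps)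
  qed
  have DinvEs: "lozi_deriv_inv (?e p) w \<in> Es p" if "w \<in> Es (?L p)" for p w
  proof -
    have "snd w = (n p * (a * ?e p - n (?L p))) * snd w" using n(2) by simp
    then show ?thesis using that by (simp add: Es_def lozi_deriv_inv_def case_prod_unfold algebra_simps)
  qed
  have DEu: "lozi_deriv (?e p) w \<in> Eu (?L p)" if "w \<in> Eu p" for p w
  proof -
    have "fst w = (m (?L p) * (a * ?e p - m p)) * fst w" using mL by simp
    then show ?thesis using that by (simp add: Eu_def lozi_deriv_def case_prod_unfold algebra_simps)
  qed
  have DinvEu: "lozi_deriv_inv (?e p) w \<in> Eu p" if "w \<in> Eu (?L p)" for p w
  proof -
    have "fst w = (m (?L p) * (a * ?e p - m p)) * fst w" using mL by simp
    then show ?thesis using that by (simp add: Eu_def lozi_deriv_inv_def case_prod_unfold algebra_simps)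
  qed
  have norm_le: "norm w \<le> \<bar>fst w\<bar> + \<bar>snd w\<bar>" for w :: "real \<times> real"
    by (simp add: norm_prod_def sqrt_sum_squares_le_sum_abs)
  have half: "\<bar>t * x\<bar> \<le> 1/2 * \<bar>x\<bar>" if "\<bar>t\<bar> \<le> 1/2" for t x :: real
    unfolding abs_mult by (rule mult_right_mono[OF that]) simp
  \<comment> \<open>On \<open>Es p\<close> the first coordinate is at most half the second in
    absolute value. The new second coordinate is the negated first one, hence the rate 1/2, and the
    norm is at most 3/2 of the second coordinate, hence \<open>C = 2\<close>.\<close>
  have Es_bound: "norm (frechet_derivative (?L ^^ k) (at p) v) \<le> 2 * (1/2) ^ k * norm v"
    if "p \<in> saddle" "v \<in> Es p" for p v k
  proof (rule frechet_derivative_funpow_bound[where A = saddle and N = "\<lambda>w. \<bar>snd w\<bar>" and E = Es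
        and D = "\<lambda>p. lozi_deriv (?e p)"])
    fix p v assume p: "p \<in> saddle"
    show "?L p \<in> saddle" using p by (simp add: lozi_saddle_iff)
    show "(?L has_derivative lozi_deriv (?e p)) (at p)" by (rule has_derivative_lozi[OF fst_saddle[OF p]])
    assume v: "v \<in> Es p"
    show "lozi_deriv (?e p) v \<in> Es (?L p)" by (rule DEs[OF v])
    show "\<bar>snd (lozi_deriv (?e p) v)\<bar> \<le> 1/2 * \<bar>snd v\<bar>"
      using v half[OF n(1)] by (simp add: lozi_deriv_def Es_def case_prod_unfold)
    show "norm v \<le> 2 * \<bar>snd v\<bar>"
      using norm_le[of v] half[OF n(1), of p "snd v"] v unfolding Es_def by simp
  qed (use that norm_snd_le[where 'a = real and 'b = real] in \<open>auto simp: prod_eq_iff\<close>)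
  \<comment> \<open>The same for the inverse with the coordinates exchanged. Its derivative at
    \<open>p\<close> takes the sign from the preimage of \<open>p\<close>.\<close>
  have Eu_bound: "norm (frechet_derivative (inv ?L ^^ k) (at p) v) \<le> 2 * (1/2) ^ k * norm v"
    if "p \<in> saddle" "v \<in> Eu p" for p v k
  proof (rule frechet_derivative_funpow_bound[where A = saddle and N = "\<lambda>w. \<bar>fst w\<bar>" and E = Eu
        and D = "\<lambda>p. lozi_deriv_inv (?e (inv ?L p))"])
    fix p v assume p: "p \<in> saddle"
    show "inv ?L p \<in> saddle" by (rule inv_lozi_saddle[OF p])
    show "(inv ?L has_derivative lozi_deriv_inv (?e (inv ?L p))) (at p)"
      using has_derivative_inv_lozi[OF snd_saddle[OF p]] by (simp add: neg_snd_eq)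
    assume v: "v \<in> Eu p"
    show "lozi_deriv_inv (?e (inv ?L p)) v \<in> Eu (inv ?L p)"
      by (rule DinvEu) (simp add: v surj_f_inv_f[OF bij_is_surj[OF bij_lozi]])
    show "\<bar>fst (lozi_deriv_inv (?e (inv ?L p)) v)\<bar> \<le> 1/2 * \<bar>fst v\<bar>"
      using v half[OF m(1)] by (simp add: lozi_deriv_inv_def Eu_def case_prod_unfold)
    show "norm v \<le> 2 * \<bar>fst v\<bar>"
      using norm_le[of v] half[OF m(1), of p "fst v"] v unfolding Eu_def by simp
  qed (use that norm_fst_le[where 'a = real and 'b = real] in \<open>auto simp: prod_eq_iff\<close>)
  show "\<exists>Es Eu C r. 0 < C \<and> 0 < r \<and> r < 1 \<and>
        (\<forall>p\<in>saddle.
           subspace (Es p) \<and> subspace (Eu p) \<and>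
           Es p \<inter> Eu p = {0} \<and> (\<forall>w. \<exists>u\<in>Es p. \<exists>v\<in>Eu p. w = u + v) \<and>
           frechet_derivative ?L (at p) ` Es p = Es (?L p) \<and>
           frechet_derivative ?L (at p) ` Eu p = Eu (?L p) \<and>
           (\<forall>n. \<forall>v\<in>Es p. norm (frechet_derivative (?L ^^ n) (at p) v) \<le> C * r ^ n * norm v) \<and>
           (\<forall>n. \<forall>v\<in>Eu p. norm (frechet_derivative (inv ?L ^^ n) (at p) v) \<le> C * r ^ n * norm v))"
  proof (rule exI[of _ Es], rule exI[of _ Eu], rule exI[of _ 2], rule exI[of _ "1/2"],
      intro conjI ballI allI)
    fix p assume p: "p \<in> saddle"
    show "subspace (Es p)" "subspace (Eu p)"
      by (auto simp: Es_def Eu_def subspace_def algebra_simps)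
    show "Es p \<inter> Eu p = {0}"
    proof -
      have "w = 0" if "fst w = n p * snd w" "snd w = m p * fst w" for w
      proof -
        have "snd w = m p * (n p * snd w)"
          unfolding that(1)[symmetric] by (rule that(2))
        then have "snd w = 0" using mn[of p] by (metis mult.assoc mult_cancel_right1)
        then show ?thesis using that(1) by (simp add: prod_eq_iff)
      qed
      then have "w = 0" if "w \<in> Es p" "w \<in> Eu p" for w
        using that unfolding Es_def Eu_def by blast
      moreover have "0 \<in> Es p" "0 \<in> Eu p" by (simp_all add: Es_def Eu_def)
      ultimately show ?thesis by blast
    qed
    show "\<exists>u\<in>Es p. \<exists>v\<in>Eu p. w = u + v" for w
    proof -
      let ?d = "1 - m p * n p"
      \<comment> \<open>Cramer's rule for \<open>fst w = x + n p * t\<close> and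
        \<open>snd w = m p * x + t\<close>, with determinant \<open>1 - m p * n p\<close>.\<close>
      define t where "t = (snd w - m p * fst w) / ?d"
      define x where "x = (fst w - n p * snd w) / ?d"
      have "?d \<noteq> 0" using mn[of p] by simp
      then have "?d * (x + n p * t) = ?d * fst w" "?d * (m p * x + t) = ?d * snd w"
        by (simp_all add: t_def x_def distrib_left) (simp_all add: algebra_simps)
      then have "w = (n p * t, t) + (x, m p * x)"
        using \<open>?d \<noteq> 0\<close> by (simp add: prod_eq_iff)
      then show ?thesis by (intro bexI[of _ "(n p * t, t)"] bexI[of _ "(x, m p * x)"])
        (simp_all add: Es_def Eu_def)
    qed
    show "frechet_derivative ?L (at p) ` Es p = Es (?L p)"
      unfolding fd[OF p] by (rule imgI) (auto intro: DEs DinvEs)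
    show "frechet_derivative ?L (at p) ` Eu p = Eu (?L p)"
      unfolding fd[OF p] by (rule imgI) (auto intro: DEu DinvEu)
  qed (use Es_bound Eu_bound in auto)
qed

end

theorem theorem4:
  fixes a R :: real
    and S :: "(real \<times> real) set"
    and H V :: "nat \<Rightarrow> (real \<times> real) set"
  assumes "a > 4"
    and "R = a / (4 * (a - 2))"
    and "S = {-R..R} \<times> {-R..R}"
    and "H 1 = {(x, y). (x, y) \<in> lozi a ` S \<inter> S \<and> y > 0}"
    and "H 2 = {(x, y). (x, y) \<in> lozi a ` S \<inter> S \<and> y < 0}"
    and "V 1 = {(x, y). (x, y) \<in> lozi a -` S \<inter> S \<and> x < 0}"
    and "V 2 = {(x, y). (x, y) \<in> lozi a -` S \<inter> S \<and> x > 0}"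
  shows "(\<exists>\<mu>h \<mu>v \<nu>h \<nu>v.
            0 \<le> \<mu>h \<and> 0 \<le> \<mu>v \<and> \<nu>h \<in> {0<..<1} \<and> \<nu>v \<in> {0<..<1} \<and>
            horizontal_strip R \<mu>h (H 1) \<and> horizontal_strip R \<mu>h (H 2) \<and> H 1 \<inter> H 2 = {} \<and>
            vertical_strip R \<mu>v (V 1) \<and> vertical_strip R \<mu>v (V 2) \<and> V 1 \<inter> V 2 = {} \<and>
            conley_moser1 (lozi a) R \<mu>h \<mu>v H V \<and>
            conley_moser2 (lozi a) R \<mu>h \<mu>v \<nu>h \<nu>v H V)
       \<and> (\<exists>\<Lambda> \<phi>.
            \<Lambda> \<subseteq> S \<and> cantor_set \<Lambda> \<and> lozi a ` \<Lambda> = \<Lambda> \<and>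
            (\<forall>p\<in>\<Lambda>. fst p \<noteq> 0) \<and> hyperbolic_set (lozi a) \<Lambda> \<and>
            homeomorphic_map (top_of_set \<Lambda>) full_shift_space \<phi> \<and>
            (\<forall>p\<in>\<Lambda>. \<phi> (lozi a p) = shift (\<phi> p)))"
proof -
  interpret lozi_horseshoe a R by unfold_locales fact+
  have H: "H 1 = image_strip 1" "H 2 = image_strip (- 1)"
    and V: "V 1 = preimage_strip 1" "V 2 = preimage_strip (- 1)"
    unfolding assms(3-7) image_strip_def preimage_strip_def set_eq_iff split_paired_All
    by (simp_all add: conj_ac del: image_iff)
  show ?thesis
  proof (intro conjI)
    show "\<exists>\<mu>h \<mu>v \<nu>h \<nu>v.
            0 \<le> \<mu>h \<and> 0 \<le> \<mu>v \<and> \<nu>h \<in> {0<..<1} \<and> \<nu>v \<in> {0<..<1} \<and>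
            horizontal_strip R \<mu>h (H 1) \<and> horizontal_strip R \<mu>h (H 2) \<and> H 1 \<inter> H 2 = {} \<and>
            vertical_strip R \<mu>v (V 1) \<and> vertical_strip R \<mu>v (V 2) \<and> V 1 \<inter> V 2 = {} \<and>
            conley_moser1 (lozi a) R \<mu>h \<mu>v H V \<and>
            conley_moser2 (lozi a) R \<mu>h \<mu>v \<nu>h \<nu>v H V"
      by (intro exI[of _ "1/2"] conjI conley_moser_lozi[OF H V]) auto
    show "\<exists>\<Lambda> \<phi>.
            \<Lambda> \<subseteq> S \<and> cantor_set \<Lambda> \<and> lozi a ` \<Lambda> = \<Lambda> \<and>
            (\<forall>p\<in>\<Lambda>. fst p \<noteq> 0) \<and> hyperbolic_set (lozi a) \<Lambda> \<and>
            homeomorphic_map (top_of_set \<Lambda>) full_shift_space \<phi> \<and>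
            (\<forall>p\<in>\<Lambda>. \<phi> (lozi a p) = shift (\<phi> p))"
      using saddle_subset assms(3) cantor_saddle image_saddle fst_saddle hyperbolic_saddle
        homeomorphic_itinerary itinerary_lozi by blast
  qed
qed

end
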